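(* Let $\phi$ be the solution of the stationary problem and $\psi=1-\phi$. There exists a constant $C^*$ such that, with $\psi^*(x)=C^*|x|^{2-N}$, for every multi-index $\beta\in\mathbb{N}_0^N$ of order $|\beta|=s$, $$|x|^{N-2+s}\,\bigl|D^\beta\psi(x)-D^\beta\psi^*(x)\bigr|\to0\quad\text{as } |x|\to\infty.$$
   Context: Setting: $N\ge 3$; $\mathcal{H}\subset\mathbb{R}^N$ is a bounded open set with smooth boundary (not necessarily connected), $0\in\mathcal{H}$, and $\Omega=\mathbb{R}^N\setminus\mathcal{H}$. The kernel $J:\mathbb{R}^N\to[0,\infty)$ is smooth, radially symmetric, compactly supported in the unit ball centered at the origin, with $J(0)>0$ and $\int_{\mathbb{R}^N}J=1$. Stationary problem: $\phi\in L^1_{\rm loc}(\mathbb{R}^N)$ is the unique solution of $J*\phi=\phi$ in $\Omega$, $\phi=0$ in $\mathcal{H}$, $\phi(x)\to1$ as $|x|\to\infty$. In $\Omega$ the function $\phi=J*\phi$ is smooth. Notation: $D^\beta f=\partial_{x_1}^{\beta_1}\cdots\partial_{x_N}^{\beta_N}f$, $|\beta|=\beta_1+\dots+\beta_N$. *)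

theory Defs
  imports "HOL-Analysis.Analysis"
begin

definition partial_deriv :: "'n \<Rightarrow> (real^'n \<Rightarrow> real) \<Rightarrow> real^'n \<Rightarrow> real" where
  "partial_deriv i f x = deriv (\<lambda>t. f (x + t *\<^sub>R axis i 1)) 0"

(* The order on the index type numbers the coordinates x_1 < ... < x_N, and D^beta f is
   (d/dx_1)^(beta_1) (... ((d/dx_N)^(beta_N) f)), read from left to right as written.
   The sort {finite,wellorder} is the one used by the change of variables theory; every
   cardinality N >= 1 is realised by a type of this sort. *)
definition multi_deriv ::
    "nat^'n::{finite,wellorder} \<Rightarrow> (real^'n::{finite,wellorder} \<Rightarrow> real) \<Rightarrow> real^'n::{finite,wellorder} \<Rightarrow> real" where
  "multi_deriv \<beta> f = foldr (\<lambda>i. partial_deriv i ^^ (\<beta> $ i)) (sorted_list_of_set UNIV) f"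

definition multi_order :: "nat^'n \<Rightarrow> nat" where
  "multi_order \<beta> = (\<Sum>i\<in>UNIV. \<beta> $ i)"

(* C^k on an open set U. Requiring Frechet differentiability at the intermediate orders is no
   restriction, and it rules out the arbitrary value of deriv where no derivative exists. *)
primrec Ck_on :: "nat \<Rightarrow> (real^'n) set \<Rightarrow> (real^'n \<Rightarrow> real) \<Rightarrow> bool" where
  "Ck_on 0 U f \<longleftrightarrow> continuous_on U f"
| "Ck_on (Suc k) U f \<longleftrightarrow>
     (\<forall>x\<in>U. f differentiable (at x)) \<and> (\<forall>i. Ck_on k U (partial_deriv i f))"

definition smooth_on :: "(real^'n) set \<Rightarrow> (real^'n \<Rightarrow> real) \<Rightarrow> bool" where
  "smooth_on U f \<longleftrightarrow> (\<forall>k. Ck_on k U f)"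

(* Smooth boundary of an open set H, by local defining functions with nonvanishing gradient.
   It follows that frontier H \<inter> U = {x \<in> U. \<rho> x = 0} and that H lies locally on one
   side of its boundary. *)
definition smooth_boundary :: "(real^'n) set \<Rightarrow> bool" where
  "smooth_boundary H \<longleftrightarrow>
     (\<forall>p\<in>frontier H. \<exists>U \<rho>. open U \<and> p \<in> U \<and> smooth_on U \<rho> \<and>
        (\<forall>x\<in>U. \<exists>i. partial_deriv i \<rho> x \<noteq> 0) \<and>
        H \<inter> U = {x \<in> U. \<rho> x < 0})"

definition dispersal_kernel :: "(real^'n \<Rightarrow> real) \<Rightarrow> bool" where
  "dispersal_kernel J \<longleftrightarrow>
     (\<forall>x. 0 \<le> J x) \<and>
     smooth_on UNIV J \<and>
     (\<forall>x y. norm x = norm y \<longrightarrow> J x = J y) \<and>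
     closure {x. J x \<noteq> 0} \<subseteq> cball 0 1 \<and>
     0 < J 0 \<and>
     (LINT x|lebesgue. J x) = 1"

definition convol :: "(real^'n \<Rightarrow> real) \<Rightarrow> (real^'n \<Rightarrow> real) \<Rightarrow> real^'n \<Rightarrow> real" where
  "convol f g x = (LINT y|lebesgue. f (x - y) * g y)"

definition locally_integrable :: "(real^'n \<Rightarrow> real) \<Rightarrow> bool" where
  "locally_integrable f \<longleftrightarrow> (\<forall>K. compact K \<longrightarrow> f absolutely_integrable_on K)"

(* The equations hold at every point, i.e. phi is the representative of its L^1_loc class that
   equals the smooth function J * phi on all of Omega = - H and vanishes on H. *)
definition stationary_solution ::
    "(real^'n \<Rightarrow> real) \<Rightarrow> (real^'n) set \<Rightarrow> (real^'n \<Rightarrow> real) \<Rightarrow> bool" where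
  "stationary_solution J H \<phi> \<longleftrightarrow>
     locally_integrable \<phi> \<and>
     (\<forall>x\<in>- H. convol J \<phi> x = \<phi> x) \<and>
     (\<forall>x\<in>H. \<phi> x = 0) \<and>
     (\<phi> \<longlongrightarrow> 1) at_infinity"

end

theory Submission
  imports Defs "HOL-Real_Asymp.Real_Asymp"
begin

text \<open>
  Write \<open>N\<close> for the dimension, \<open>E(x) = |x|^(2-N)\<close>, \<open>\<psi> = 1 - \<phi>\<close> and \<open>*\<close> for convolution. Off \<open>H\<close> we have
  \<open>\<psi> = J * \<psi>\<close>, so \<open>f = \<psi> - J * \<psi>\<close> is bounded with bounded support, and the theorem is about the far
  field of the solution of \<open>\<psi> - J * \<psi> = f\<close> that tends to 0.

  Because \<open>J\<close> is radial, the mean value property of the harmonic function \<open>E\<close> gives \<open>J * E = E\<close>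
  exactly, outside the unit ball (\<open>mean_value_newton_kernel\<close>). Hence \<open>P(x) = max(|x|,1)^(2-N)\<close> is
  almost a Green function of \<open>\<delta> - J\<close>: its defect \<open>\<kappa> = P - J * P\<close> is continuous, radial, nonnegative,
  supported in the ball of radius 2, and has a mass \<open>a > 0\<close>. The function \<open>v = (P * f) / a\<close> is a
  Newtonian potential far out. Every derivative of \<open>E\<close> is homogeneous and continuous off the origin,
  which yields the asymptotics of all derivatives of \<open>v\<close>, with the constant \<open>C = (\<integral> f) / a\<close>
  (\<open>homogeneous_potential_asymptotics\<close>).

  It remains to see that \<open>w = \<psi> - v\<close> and its derivatives decay faster than any power; the decay is in
  fact exponential. Two relations hold far out. First, \<open>w - J * w = f - (\<kappa> * f) / a\<close> vanishes there.
  Secondly, \<open>\<kappa> * w = 0\<close> there: the function \<open>\<kappa> * w - (P - (\<kappa> * P) / a) * f\<close> is invariant under averaging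
  with \<open>J\<close> and tends to 0, so it is 0 by the maximum principle (\<open>J_averaged_eq_0\<close>), while
  \<open>\<kappa> * P = a P\<close> far out, again by the mean value property (\<open>potential_approximation\<close>). These relations
  do not allow \<open>w\<close> to come close to a bound \<open>M\<close> for \<open>w\<close> on a large ball around \<open>x\<close>. Indeed \<open>w(x)\<close> is also the average
  of \<open>w\<close> with respect to the \<open>n\<close>-fold convolution power \<open>J_n\<close> of \<open>J\<close>, and \<open>\<kappa> \<le> K J_n\<close> for suitable \<open>n\<close> and \<open>K\<close>, so
  that \<open>a M = (\<kappa> * (M - w))(x) \<le> K (J_n * (M - w))(x) = K (M - w(x))\<close>, that is, \<open>w(x) \<le> (1 - a / K) M\<close>
  (\<open>contraction\<close>). Iteration gives exponential decay, and \<open>w = J * w\<close> passes it on to all derivatives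
  (\<open>pd_of_J_averaged\<close>).
\<close>

section \<open>Bounded Borel functions and convolution\<close>

definition bounded_borel :: "('a::euclidean_space \<Rightarrow> real) \<Rightarrow> bool" where
  "bounded_borel f \<longleftrightarrow> f \<in> borel_measurable borel \<and> (\<exists>M. \<forall>x. \<bar>f x\<bar> \<le> M)"

text \<open>The suffix cs stands for compact support.\<close>

definition bounded_borel_cs :: "('a::euclidean_space \<Rightarrow> real) \<Rightarrow> bool" where
  "bounded_borel_cs f \<longleftrightarrow> bounded_borel f \<and> (\<exists>r. \<forall>x. norm x > r \<longrightarrow> f x = 0)"

lemma bounded_borel_csI:
  assumes "f \<in> borel_measurable borel" "\<And>x. \<bar>f x\<bar> \<le> M" "\<And>x. norm x > r \<Longrightarrow> f x = 0"
  shows "bounded_borel_cs f"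
  using assms unfolding bounded_borel_cs_def bounded_borel_def by blast

lemma bounded_borel_cs_imp: "bounded_borel_cs f \<Longrightarrow> bounded_borel f"
  by (simp add: bounded_borel_cs_def)

lemma bounded_borel_measurable: "bounded_borel f \<Longrightarrow> f \<in> borel_measurable borel"
  by (simp add: bounded_borel_def)

lemma bounded_borel_bound:
  assumes "bounded_borel f" obtains M where "M > 0" "\<And>x. \<bar>f x\<bar> \<le> M"
proof -
  obtain M where M: "\<And>x. \<bar>f x\<bar> \<le> M" using assms unfolding bounded_borel_def by blast
  have "\<bar>f x\<bar> \<le> \<bar>M\<bar> + 1" for x using M[of x] by linarith
  then show ?thesis by (intro that[of "\<bar>M\<bar> + 1"]) auto
qed

lemma bounded_borel_cs_support:
  assumes "bounded_borel_cs f" obtains r where "r > 0" "\<And>x. norm x > r \<Longrightarrow> f x = 0"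
proof -
  obtain r where "\<And>x. norm x > r \<Longrightarrow> f x = 0"
    using assms unfolding bounded_borel_cs_def by blast
  then show ?thesis by (intro that[of "\<bar>r\<bar> + 1"]) auto
qed

lemma bounded_borel_const [simp]: "bounded_borel (\<lambda>_. c)"
  unfolding bounded_borel_def by auto

lemma bounded_borel_add:
  assumes "bounded_borel f" "bounded_borel g" shows "bounded_borel (\<lambda>x. f x + g x)"
proof -
  obtain M where M: "\<And>x. \<bar>f x\<bar> \<le> M" using bounded_borel_bound[OF assms(1)] by metis
  obtain M' where M': "\<And>x. \<bar>g x\<bar> \<le> M'" using bounded_borel_bound[OF assms(2)] by metis
  have "\<bar>f x + g x\<bar> \<le> M + M'" for x using M[of x] M'[of x] by linarith
  then show ?thesis using assms unfolding bounded_borel_def by (auto intro: borel_measurable_add)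
qed

lemma bounded_borel_mult:
  assumes "bounded_borel f" "bounded_borel g" shows "bounded_borel (\<lambda>x. f x * g x)"
proof -
  obtain M where M: "M > 0" "\<And>x. \<bar>f x\<bar> \<le> M" using bounded_borel_bound[OF assms(1)] by metis
  obtain M' where M': "\<And>x. \<bar>g x\<bar> \<le> M'" using bounded_borel_bound[OF assms(2)] by metis
  have "\<bar>f x * g x\<bar> \<le> M * M'" for x
    unfolding abs_mult using M M'[of x] by (intro mult_mono) auto
  then show ?thesis using assms unfolding bounded_borel_def by (auto intro: borel_measurable_times)
qed

lemma bounded_borel_cmult: "bounded_borel f \<Longrightarrow> bounded_borel (\<lambda>x. c * f x)"
  using bounded_borel_mult[of "\<lambda>_. c" f] by simp

lemma bounded_borel_diff:
  assumes "bounded_borel f" "bounded_borel g" shows "bounded_borel (\<lambda>x. f x - g x)"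
  using bounded_borel_add[OF assms(1) bounded_borel_cmult[OF assms(2), of "-1"]] by simp

lemma bounded_borel_indicator: "A \<in> sets borel \<Longrightarrow> bounded_borel (indicator A)"
  unfolding bounded_borel_def by (auto simp: indicator_def intro!: borel_measurable_indicator exI[of _ 1])

lemma bounded_borel_compose:
  assumes "bounded_borel f" "g \<in> borel_measurable borel" shows "bounded_borel (\<lambda>x. f (g x))"
  using assms unfolding bounded_borel_def by (auto intro: measurable_compose[of g])

lemma bounded_borel_cs_mult:
  assumes "bounded_borel_cs f" "bounded_borel g" shows "bounded_borel_cs (\<lambda>x. f x * g x)"
  using assms bounded_borel_mult[of f g] unfolding bounded_borel_cs_def by fastforce

lemma bounded_borel_cs_cmult: "bounded_borel_cs f \<Longrightarrow> bounded_borel_cs (\<lambda>x. c * f x)"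
  using bounded_borel_cs_mult[of f "\<lambda>_. c"] by (simp add: mult.commute)

lemma bounded_borel_cs_add:
  assumes "bounded_borel_cs f" "bounded_borel_cs g" shows "bounded_borel_cs (\<lambda>x. f x + g x)"
proof -
  obtain r where r: "\<And>x. norm x > r \<Longrightarrow> f x = 0" using bounded_borel_cs_support[OF assms(1)] by metis
  obtain r' where r': "\<And>x. norm x > r' \<Longrightarrow> g x = 0" using bounded_borel_cs_support[OF assms(2)] by metis
  have "\<forall>x. norm x > max r r' \<longrightarrow> f x + g x = 0" using r r' by auto
  then show ?thesis
    using bounded_borel_add[OF assms[THEN bounded_borel_cs_imp]] unfolding bounded_borel_cs_def by blast
qed

lemma bounded_borel_cs_diff:
  assumes "bounded_borel_cs f" "bounded_borel_cs g" shows "bounded_borel_cs (\<lambda>x. f x - g x)"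
  using bounded_borel_cs_add[OF assms(1) bounded_borel_cs_cmult[OF assms(2), of "-1"]] by simp

lemma bounded_borel_cs_reflect:
  assumes "bounded_borel_cs f" shows "bounded_borel_cs (\<lambda>y. f (x - y))"
proof -
  obtain r where r: "\<And>x. norm x > r \<Longrightarrow> f x = 0" using bounded_borel_cs_support[OF assms(1)] by metis
  have "f (x - y) = 0" if "norm y > norm x + r" for y
  proof (rule r) show "r < norm (x - y)" using that norm_triangle_ineq2[of y x] by (simp add: norm_minus_commute) qed
  moreover have "bounded_borel (\<lambda>y. f (x - y))"
    using bounded_borel_compose[OF bounded_borel_cs_imp[OF assms], of "\<lambda>y. x - y"] by simp
  ultimately show ?thesis unfolding bounded_borel_cs_def by blast
qed

lemma bounded_borel_cs_integrable:
  assumes "bounded_borel_cs f" shows "integrable lborel f"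
proof -
  obtain r where r: "\<And>x. norm x > r \<Longrightarrow> f x = 0" using bounded_borel_cs_support[OF assms] by metis
  obtain M where M: "\<And>x. \<bar>f x\<bar> \<le> M" "M > 0"
    using bounded_borel_bound[OF bounded_borel_cs_imp[OF assms]] by metis
  show ?thesis
  proof (rule Bochner_Integration.integrable_bound)
    show "integrable lborel (\<lambda>x::'a. indicator (cball 0 r) x *\<^sub>R M)"
      using emeasure_compact_finite[of "cball (0::'a) r"]
      by (intro integrable_mult_indicator integrable_scaleR_left integrable_real_indicator) auto
    show "f \<in> borel_measurable lborel"
      using bounded_borel_measurable[OF bounded_borel_cs_imp[OF assms]] by simp
    show "AE x in lborel. norm (f x) \<le> norm (indicator (cball 0 r) x *\<^sub>R M)"
      using r M by (auto simp: indicator_def not_le)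
  qed
qed

lemma continuous_cs_bounded_borel_cs:
  fixes f :: "'a::euclidean_space \<Rightarrow> real"
  assumes c: "continuous_on UNIV f" and r: "\<And>x. norm x > r \<Longrightarrow> f x = 0"
  shows "bounded_borel_cs f"
proof -
  have "compact (f ` cball 0 r)"
    by (intro compact_continuous_image continuous_on_subset[OF c]) auto
  then obtain M where M: "\<And>x. x \<in> cball 0 r \<Longrightarrow> \<bar>f x\<bar> \<le> M"
    using compact_imp_bounded[of "f ` cball 0 r"] unfolding bounded_iff by (metis imageI real_norm_def)
  have "\<bar>f x\<bar> \<le> \<bar>M\<bar>" for x using M[of x] r[of x] by (cases "norm x > r") auto
  then show ?thesis
    using r borel_measurable_continuous_onI[OF c] by (intro bounded_borel_csI[where r=r])
qed

text \<open>Borel measure is chosen because it is compatible with products of spaces, as Fubini requires. On Borel functions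
  \<open>conv\<close> agrees with \<open>convol\<close>, which integrates over the completed measure.\<close>

definition conv :: "('a::euclidean_space \<Rightarrow> real) \<Rightarrow> ('a \<Rightarrow> real) \<Rightarrow> 'a \<Rightarrow> real" where
  "conv k f x = (LINT y|lborel. k (x - y) * f y)"

lemma integral_lborel_reflect:
  fixes f :: "'a::euclidean_space \<Rightarrow> real"
  shows "(LINT y|lborel. f (x - y)) = (LINT y|lborel. f y)"
proof (cases "f \<in> borel_measurable borel")
  case True
  have "lborel = density (distr lborel borel (\<lambda>y. x + (-1) *\<^sub>R y)) (\<lambda>_. ennreal (\<bar>-1\<bar>^DIM('a)))"
    by (rule lborel_affine) simp
  then have "lborel = distr lborel borel (\<lambda>y::'a. x - y)"
    by (simp add: density_1)
  then have "(LINT y|lborel. f y) = (LINT y|distr lborel borel (\<lambda>y::'a. x - y). f y)" by simp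
  also have "\<dots> = (LINT y|lborel. f (x - y))"
    by (rule integral_distr) (use True in auto)
  finally show ?thesis by simp
next
  case False
  have "(\<lambda>y. f (x - y)) \<notin> borel_measurable borel"
  proof
    assume "(\<lambda>y. f (x - y)) \<in> borel_measurable borel"
    then have "(\<lambda>y. f (x - (x - y))) \<in> borel_measurable borel"
      by (rule measurable_compose[rotated]) simp
    then show False using False by simp
  qed
  then show ?thesis using False by (simp add: not_integrable_integral_eq integrable_iff_bounded)
qed

lemma integral_lborel_shift:
  fixes f :: "'a::euclidean_space \<Rightarrow> real"
  shows "(LINT y|lborel. f (y + z)) = (LINT y|lborel. f y)"
  using integral_lborel_reflect[of "\<lambda>y. f (z - y)" 0] integral_lborel_reflect[of f z]
  by (simp add: add.commute)

lemma conv_commute: "conv k f = conv f k"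
proof
  fix x show "conv k f x = conv f k x"
    unfolding conv_def
    using integral_lborel_reflect[of "\<lambda>y. k (x - y) * f y" x] by (simp add: mult.commute)
qed

lemma conv_integrand_cs:
  "bounded_borel_cs k \<Longrightarrow> bounded_borel f \<Longrightarrow> bounded_borel_cs (\<lambda>y. k (x - y) * f y)"
  by (intro bounded_borel_cs_mult bounded_borel_cs_reflect)

lemma conv_integrable:
  "bounded_borel_cs k \<Longrightarrow> bounded_borel f \<Longrightarrow> integrable lborel (\<lambda>y. k (x - y) * f y)"
  by (intro bounded_borel_cs_integrable conv_integrand_cs)

lemma conv_diff:
  assumes "bounded_borel_cs k" "bounded_borel f" "bounded_borel g"
  shows "conv k (\<lambda>x. f x - g x) x = conv k f x - conv k g x"
  unfolding conv_def right_diff_distrib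
  by (intro Bochner_Integration.integral_diff conv_integrable assms)

lemma conv_cmult: "conv k (\<lambda>x. c * f x) x = c * conv k f x"
  unfolding conv_def by (simp add: mult.left_commute)

lemma conv_diff_cmult:
  assumes "bounded_borel_cs k" "bounded_borel f" "bounded_borel g"
  shows "conv k (\<lambda>x. f x - b * g x) x = conv k f x - b * conv k g x"
  using conv_diff[OF assms(1,2) bounded_borel_cmult[OF assms(3)]] by (simp add: conv_cmult)

lemma conv_const: "conv k (\<lambda>_. c) x = c * (LINT y|lborel. k y)"
  unfolding conv_def using integral_lborel_reflect[of k x] by simp

lemma conv_cong:
  assumes "\<And>y. norm (x - y) \<le> r \<Longrightarrow> f y = g y" "\<And>z. norm z > r \<Longrightarrow> k z = 0"
  shows "conv k f x = conv k g x"
  proof -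
  have "k (x - y) * f y = k (x - y) * g y" for y
    using assms(1)[of y] assms(2)[of "x - y"] by (cases "norm (x - y) \<le> r") auto
  then show ?thesis unfolding conv_def by presburger
qed

lemma conv_mono:
  assumes "bounded_borel_cs k" "bounded_borel f" "bounded_borel g"
    and "\<And>z. 0 \<le> k z" "\<And>y. norm (x - y) \<le> r \<Longrightarrow> f y \<le> g y" "\<And>z. norm z > r \<Longrightarrow> k z = 0"
  shows "conv k f x \<le> conv k g x"
proof -
  have "k (x - y) * f y \<le> k (x - y) * g y" for y
    using assms(4)[of "x - y"] assms(5)[of y] assms(6)[of "x - y"]
    by (cases "norm (x - y) \<le> r") (auto intro: mult_left_mono)
  then show ?thesis unfolding conv_def
    by (intro integral_mono conv_integrable assms(1-3))
qed

lemma conv_abs_le: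
  assumes "bounded_borel_cs k" "bounded_borel f"
    and "\<And>y. norm (x - y) \<le> r \<Longrightarrow> \<bar>f y\<bar> \<le> M" "\<And>z. norm z > r \<Longrightarrow> k z = 0"
  shows "\<bar>conv k f x\<bar> \<le> (LINT y|lborel. \<bar>k y\<bar>) * M"
proof -
  have ka: "bounded_borel_cs (\<lambda>z. \<bar>k z\<bar>)"
    using assms(1) unfolding bounded_borel_cs_def bounded_borel_def by auto
  have "\<bar>conv k f x\<bar> \<le> (LINT y|lborel. \<bar>k (x - y)\<bar> * M)"
    unfolding conv_def
  proof (rule integral_abs_bound_integral)
    show "integrable lborel (\<lambda>y. \<bar>k (x - y)\<bar> * M)"
      using conv_integrable[OF ka, of "\<lambda>_. M"] by simp
    show "\<bar>k (x - y) * f y\<bar> \<le> \<bar>k (x - y)\<bar> * M" for y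
      using assms(3)[of y] assms(4)[of "x - y"]
      by (cases "norm (x - y) \<le> r") (auto simp: abs_mult intro: mult_left_mono)
  qed (rule conv_integrable[OF assms(1,2)])
  also have "\<dots> = (LINT y|lborel. \<bar>k y\<bar>) * M"
    using integral_lborel_reflect[of "\<lambda>z. \<bar>k z\<bar>" x] by simp
  finally show ?thesis .
qed

lemma bounded_borel_conv:
  assumes "bounded_borel_cs k" "bounded_borel f" shows "bounded_borel (conv k f)"
proof -
  obtain M where M: "\<And>x. \<bar>f x\<bar> \<le> M" using bounded_borel_bound[OF assms(2)] by metis
  obtain r where r: "\<And>x. norm x > r \<Longrightarrow> k x = 0" using bounded_borel_cs_support[OF assms(1)] by metis
  have [measurable]: "k \<in> borel_measurable borel" "f \<in> borel_measurable borel"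
    using assms bounded_borel_cs_imp bounded_borel_measurable by blast+
  have "conv k f \<in> borel_measurable borel"
    unfolding conv_def by measurable
  moreover have "\<bar>conv k f x\<bar> \<le> (LINT y|lborel. \<bar>k y\<bar>) * M" for x
    by (rule conv_abs_le[OF assms M r])
  ultimately show ?thesis unfolding bounded_borel_def by blast
qed

lemma conv_support:
  assumes "\<And>x. norm x > r \<Longrightarrow> k x = 0" "\<And>x. norm x > s \<Longrightarrow> f x = 0" "norm x > r + s"
  shows "conv k f x = 0"
proof -
  have "k (x - y) * f y = 0" for y
    using assms norm_triangle_ineq[of "x - y" y] by (cases "norm y > s") auto
  then have "(\<lambda>y. k (x - y) * f y) = (\<lambda>y. 0)" by blast
  then show ?thesis unfolding conv_def by simp
qed

lemma bounded_borel_cs_conv: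
  assumes "bounded_borel_cs k" "bounded_borel_cs f" shows "bounded_borel_cs (conv k f)"
proof -
  obtain r where r: "\<And>x. norm x > r \<Longrightarrow> k x = 0" using bounded_borel_cs_support[OF assms(1)] by metis
  obtain s where s: "\<And>x. norm x > s \<Longrightarrow> f x = 0" using bounded_borel_cs_support[OF assms(2)] by metis
  show ?thesis using conv_support[of r k s f] r s bounded_borel_conv[OF assms(1) bounded_borel_cs_imp[OF assms(2)]]
    unfolding bounded_borel_cs_def by blast
qed

text \<open>Fubini applies because the integrand, as a function of the pair of integration variables, is again
  bounded with bounded support.\<close>

lemma conv_assoc:
  assumes k: "bounded_borel_cs k" and l: "bounded_borel_cs l" and f: "bounded_borel f"
  shows "conv k (conv l f) = conv (conv k l) f"
proof
  fix x
  obtain r where r: "\<And>x. norm x > r \<Longrightarrow> k x = 0" "r > 0" using bounded_borel_cs_support[OF k] by metis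
  obtain s where s: "\<And>x. norm x > s \<Longrightarrow> l x = 0" "s > 0" using bounded_borel_cs_support[OF l] by metis
  obtain K where K: "\<And>x. \<bar>k x\<bar> \<le> K" "K > 0" using bounded_borel_bound[OF bounded_borel_cs_imp[OF k]] by metis
  obtain L where L: "\<And>x. \<bar>l x\<bar> \<le> L" "L > 0" using bounded_borel_bound[OF bounded_borel_cs_imp[OF l]] by metis
  obtain M where M: "\<And>x. \<bar>f x\<bar> \<le> M" "M > 0" using bounded_borel_bound[OF f] by metis
  have [measurable]: "k \<in> borel_measurable borel" "l \<in> borel_measurable borel" "f \<in> borel_measurable borel"
    using k l f bounded_borel_cs_imp bounded_borel_measurable by blast+
  let ?F = "\<lambda>(y, z). k (x - y) * l (y - z) * f z"
  have "bounded_borel_cs ?F"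
  proof (rule bounded_borel_csI)
    have "?F \<in> borel_measurable (borel \<Otimes>\<^sub>M borel)" by measurable
    then show "?F \<in> borel_measurable borel" by (simp add: borel_prod)
    have "\<bar>k u\<bar> * \<bar>l v\<bar> * \<bar>f z\<bar> \<le> K * L * M" for u v z
      using K L M by (intro mult_mono mult_nonneg_nonneg) (auto intro: less_imp_le)
    then show "\<bar>?F p\<bar> \<le> K * L * M" for p
      by (simp add: abs_mult split: prod.split)
    show "?F p = 0" if "norm p > (norm x + r) + (norm x + r + s)" for p
    proof (cases p)
      case (Pair y z)
      have n: "norm p \<le> norm y + norm z" using norm_Pair_le[of y z] Pair by simp
      show ?thesis
      proof (rule ccontr)
        assume "?F p \<noteq> 0"
        then have "k (x - y) \<noteq> 0" "l (y - z) \<noteq> 0" using Pair by auto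
        then have "norm (x - y) \<le> r" "norm (y - z) \<le> s" using r s not_le by blast+
        moreover have "norm y \<le> norm x + norm (x - y)" by (metis norm_triangle_sub norm_minus_commute)
        moreover have "norm z \<le> norm y + norm (y - z)" by (metis norm_triangle_sub norm_minus_commute)
        ultimately show False using n that by linarith
      qed
    qed
  qed
  then have "integrable (lborel \<Otimes>\<^sub>M lborel) ?F"
    using bounded_borel_cs_integrable[of ?F] by (simp add: lborel_prod)
  then have F: "(LINT z|lborel. LINT y|lborel. ?F (y, z)) = (LINT y|lborel. LINT z|lborel. ?F (y, z))"
    by (intro lborel_pair.Fubini_integral) (simp add: case_prod_beta')
  have "(LINT y|lborel. LINT z|lborel. ?F (y, z)) = conv k (conv l f) x"
    unfolding conv_def by (simp add: mult.assoc)
  with F have "conv k (conv l f) x = (LINT z|lborel. LINT y|lborel. ?F (y, z))" by (simp only:)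
  moreover have I: "(LINT y|lborel. ?F (y, z)) = conv k l (x - z) * f z" for z
    unfolding conv_def using integral_lborel_shift[of "\<lambda>y. k (x - y) * l (y - z)" z]
    by (simp add: algebra_simps diff_diff_eq)
  ultimately have "conv k (conv l f) x = (LINT z|lborel. conv k l (x - z) * f z)" by (simp only: I)
  then show "conv k (conv l f) x = conv (conv k l) f x"
    by (simp only: conv_def[of "conv k l"])
qed

lemma conv_tendsto_0:
  assumes k: "bounded_borel_cs k" and f: "bounded_borel f" and lim: "(f \<longlongrightarrow> 0) at_infinity"
  shows "(conv k f \<longlongrightarrow> 0) at_infinity"
  unfolding tendsto_iff eventually_at_infinity
proof (intro allI impI)
  fix e :: real assume "e > 0"
  obtain r where r: "\<And>x. norm x > r \<Longrightarrow> k x = 0" "r > 0" using bounded_borel_cs_support[OF k] by metis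
  let ?I = "LINT y|lborel. \<bar>k y\<bar>"
  have "?I \<ge> 0" by simp
  then have "?I + 1 > 0" by linarith
  define d where "d = e / (?I + 1)"
  have "d > 0" unfolding d_def using \<open>e > 0\<close> \<open>?I + 1 > 0\<close> by (intro divide_pos_pos)
  then obtain b where b: "\<And>y. norm y \<ge> b \<Longrightarrow> \<bar>f y\<bar> < d"
    using lim unfolding tendsto_iff eventually_at_infinity by (metis dist_0_norm dist_commute real_norm_def)
  have "dist (conv k f x) 0 < e" if "norm x \<ge> b + r" for x
  proof -
    have "\<bar>conv k f x\<bar> \<le> ?I * d"
    proof (rule conv_abs_le[OF k f _ r(1)])
      show "\<bar>f y\<bar> \<le> d" if "norm (x - y) \<le> r" for y
        using b[of y] that \<open>norm x \<ge> b + r\<close> norm_triangle_sub[of x y] by (simp add: less_imp_le)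
    qed
    also have "\<dots> < e" unfolding d_def using \<open>e > 0\<close> \<open>?I + 1 > 0\<close> by (simp add: divide_simps distrib_left)
    finally show ?thesis by simp
  qed
  then show "\<exists>b. \<forall>x. b \<le> norm x \<longrightarrow> dist (conv k f x) 0 < e" by blast
qed

lemma tendsto_0_cs:
  fixes f :: "'a::euclidean_space \<Rightarrow> real"
  assumes "bounded_borel_cs f" shows "(f \<longlongrightarrow> 0) at_infinity"
proof -
  obtain r where "\<And>x. norm x > r \<Longrightarrow> f x = 0" using bounded_borel_cs_support[OF assms] by metis
  then have "\<forall>\<^sub>F x in at_infinity. f x = 0"
    unfolding eventually_at_infinity by (metis less_add_one less_le_trans)
  then show ?thesis by (rule tendsto_eventually)
qed

lemma integral_pos_of_continuous:
  fixes g :: "'a::euclidean_space \<Rightarrow> real"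
  assumes "integrable lborel g" "\<And>y. 0 \<le> g y" "continuous_on UNIV g" "g z > 0"
  shows "(LINT y|lborel. g y) > 0"
proof (rule ccontr)
  assume "\<not> ?thesis"
  moreover have "(LINT y|lborel. g y) \<ge> 0" using assms(2) by simp
  ultimately have "(LINT y|lborel. g y) = 0" by linarith
  then have "AE y in lborel. g y = 0"
    using integral_nonneg_eq_0_iff_AE[OF assms(1)] assms(2) by simp
  then have "AE y in lborel. y \<in> {y. g y = 0}" by simp
  moreover have "closed {y. g y = 0}"
    using assms(3) by (intro closed_Collect_eq) auto
  ultimately have "z \<in> {y. g y = 0}"
    using mem_closed_if_AE_lebesgue by (metis AE_completion)
  then show False using assms(4) by auto
qed

section \<open>Differentiation under the integral sign\<close>

text \<open>Dominated convergence for difference quotients, which the mean value theorem bounds by \<open>B\<close>.\<close>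

lemma DERIV_integral:
  fixes G G' :: "real \<Rightarrow> 'a::euclidean_space \<Rightarrow> real"
  assumes "\<delta> > 0"
    and int: "\<And>t. \<bar>t - t0\<bar> < \<delta> \<Longrightarrow> integrable lborel (G t)"
    and der: "\<And>t y. \<bar>t - t0\<bar> < \<delta> \<Longrightarrow> ((\<lambda>t. G t y) has_real_derivative G' t y) (at t)"
    and bd: "\<And>t y. \<bar>t - t0\<bar> < \<delta> \<Longrightarrow> \<bar>G' t y\<bar> \<le> B y"
    and B: "integrable lborel B"
  shows "((\<lambda>t. LINT y|lborel. G t y) has_real_derivative (LINT y|lborel. G' t0 y)) (at t0)"
proof -
  have "((\<lambda>h. ((LINT y|lborel. G (t0 + h) y) - (LINT y|lborel. G t0 y)) / h) \<longlongrightarrow> (LINT y|lborel. G' t0 y)) (at 0)"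
    unfolding tendsto_at_iff_sequentially comp_def
  proof (intro allI impI)
    fix X :: "nat \<Rightarrow> real"
    assume X: "\<forall>i. X i \<in> UNIV - {0}" "X \<longlonglongrightarrow> 0"
    then have "eventually (\<lambda>n. \<bar>X n\<bar> < \<delta>) sequentially"
      using \<open>\<delta> > 0\<close> unfolding tendsto_iff by simp
    then obtain K where K: "\<And>n. n \<ge> K \<Longrightarrow> \<bar>X n\<bar> < \<delta>"
      unfolding eventually_sequentially by blast
    define q where "q n y = (G (t0 + X n) y - G t0 y) / X n" for n y
    have q_int: "integrable lborel (q n)" if "n \<ge> K" for n
      unfolding q_def using int[of "t0 + X n"] int[of t0] K[OF that] \<open>\<delta> > 0\<close> by simp
    have q_lim: "(\<lambda>n. q n y) \<longlonglongrightarrow> G' t0 y" for y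
    proof -
      have "((\<lambda>h. (G (t0 + h) y - G t0 y) / h) \<longlongrightarrow> G' t0 y) (at 0)"
        using der[of t0 y] \<open>\<delta> > 0\<close> unfolding DERIV_def by simp
      then show ?thesis
        using X unfolding tendsto_at_iff_sequentially comp_def q_def by blast
    qed
    have q_bd: "\<bar>q n y\<bar> \<le> B y" if "n \<ge> K" for n y
    proof -
      have "norm (G (t0 + X n) y - G t0 y) \<le> B y * norm (t0 + X n - t0)"
      proof (rule field_differentiable_bound[where S = "{t0 - \<bar>X n\<bar>..t0 + \<bar>X n\<bar>}" and f' = "\<lambda>t. G' t y"])
        show "((\<lambda>t. G t y) has_field_derivative G' z y) (at z within {t0 - \<bar>X n\<bar>..t0 + \<bar>X n\<bar>})"
          if "z \<in> {t0 - \<bar>X n\<bar>..t0 + \<bar>X n\<bar>}" for z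
          using that K[OF \<open>n \<ge> K\<close>] by (intro has_field_derivative_at_within[OF der]) auto
        show "norm (G' z y) \<le> B y" if "z \<in> {t0 - \<bar>X n\<bar>..t0 + \<bar>X n\<bar>}" for z
          using that K[OF \<open>n \<ge> K\<close>] bd[of z y] by auto
      qed auto
      then show ?thesis using X(1) unfolding q_def by (simp add: abs_divide divide_le_eq)
    qed
    have "(\<lambda>n. LINT y|lborel. q (n + K) y) \<longlonglongrightarrow> (LINT y|lborel. G' t0 y)"
    proof (rule integral_dominated_convergence[OF _ _ B])
      show "(\<lambda>y. G' t0 y) \<in> borel_measurable lborel"
      proof (rule borel_measurable_LIMSEQ_metric)
        show "q (n + K) \<in> borel_measurable lborel" for n using q_int[of "n + K"] by auto
        show "(\<lambda>n. q (n + K) y) \<longlonglongrightarrow> G' t0 y" for y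
          using q_lim by (rule LIMSEQ_ignore_initial_segment)
      qed
      show "q (n + K) \<in> borel_measurable lborel" for n using q_int[of "n + K"] by auto
      show "AE y in lborel. (\<lambda>n. q (n + K) y) \<longlonglongrightarrow> G' t0 y"
        using q_lim by (intro AE_I2 LIMSEQ_ignore_initial_segment)
      show "AE y in lborel. norm (q (n + K) y) \<le> B y" for n using q_bd[of "n + K"] by simp
    qed
    moreover have "(LINT y|lborel. q (n + K) y)
        = ((LINT y|lborel. G (t0 + X (n + K)) y) - (LINT y|lborel. G t0 y)) / X (n + K)" for n
      unfolding q_def using int[of "t0 + X (n + K)"] int[of t0] K[of "n + K"] \<open>\<delta> > 0\<close> by simp
    ultimately show "(\<lambda>n. ((LINT y|lborel. G (t0 + X n) y) - (LINT y|lborel. G t0 y)) / X n)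
        \<longlonglongrightarrow> (LINT y|lborel. G' t0 y)"
      by - (rule LIMSEQ_offset[where k = K], simp)
  qed
  then show ?thesis unfolding DERIV_def .
qed

lemma DERIV_along_line:
  fixes f :: "'a::real_normed_vector \<Rightarrow> real"
  assumes "((\<lambda>t. f (x + s *\<^sub>R e + t *\<^sub>R e)) has_real_derivative D) (at 0)"
  shows "((\<lambda>t. f (x + t *\<^sub>R e)) has_real_derivative D) (at s)"
  using assms DERIV_shift[of "\<lambda>t. f (x + t *\<^sub>R e)" D 0 s] by (simp add: algebra_simps)

text \<open>The kernel has to be continuously differentiable (in direction \<open>e\<close>) on an open set \<open>U\<close> that contains \<open>x - S\<close>. This covers both a kernel that is smooth everywhere
  (\<open>U = UNIV\<close>) and the Newtonian kernel, which is singular at 0, at points \<open>x\<close> outside \<open>S\<close>.\<close>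

lemma conv_has_pderiv:
  fixes k k' h :: "real^'n::finite \<Rightarrow> real"
  assumes "open U" "continuous_on U k" "continuous_on U k'"
    and pd: "\<And>u. u \<in> U \<Longrightarrow> ((\<lambda>t. k (u + t *\<^sub>R e)) has_real_derivative k' u) (at 0)"
    and e: "norm e = 1"
    and "compact S" "bounded_borel h" and h0: "\<And>y. y \<notin> S \<Longrightarrow> h y = 0"
    and xS: "\<And>y. y \<in> S \<Longrightarrow> x - y \<in> U"
  shows "((\<lambda>t. conv k h (x + t *\<^sub>R e)) has_real_derivative conv k' h x) (at 0)"
proof -
  define A where "A = (\<lambda>y. x - y) ` S"
  have A: "compact A" "A \<subseteq> U"
    unfolding A_def using xS \<open>compact S\<close> by (auto intro!: compact_continuous_image continuous_intros)
  then obtain d where d: "d > 0" "(\<Union>a\<in>A. cball a d) \<subseteq> U"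
    using compact_subset_open_imp_cball_epsilon_subset[OF A(1) \<open>open U\<close> A(2)] by blast
  define C where "C = (\<Union>a\<in>A. cball a d)"
  have C: "compact C" "C \<subseteq> U" unfolding C_def using compact_minkowski_sum_cball[OF A(1)] d by auto
  \<comment> \<open>All arguments of the kernel that occur for small \<open>t\<close> stay in the compact set \<open>C\<close>.\<close>
  have inC: "x + t *\<^sub>R e - y \<in> C" if "y \<in> S" "\<bar>t\<bar> < d" for t y
  proof -
    have "x + t *\<^sub>R e - y \<in> cball (x - y) d" using that e by (simp add: dist_norm)
    then show ?thesis using that unfolding C_def A_def by blast
  qed
  obtain M where M: "\<And>u. u \<in> C \<Longrightarrow> \<bar>k' u\<bar> \<le> M"
    using compact_imp_bounded[OF compact_continuous_image[OF continuous_on_subset[OF assms(3) C(2)] C(1)]]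
    unfolding bounded_iff by (metis imageI real_norm_def)
  obtain M0 where M0: "\<And>u. u \<in> C \<Longrightarrow> \<bar>k u\<bar> \<le> M0"
    using compact_imp_bounded[OF compact_continuous_image[OF continuous_on_subset[OF assms(2) C(2)] C(1)]]
    unfolding bounded_iff by (metis imageI real_norm_def)
  have [measurable]: "h \<in> borel_measurable borel" using bounded_borel_measurable[OF assms(7)] .
  obtain r where r: "\<And>y. y \<in> S \<Longrightarrow> norm y \<le> r"
    using compact_imp_bounded[OF \<open>compact S\<close>] unfolding bounded_iff by blast
  have hcs: "bounded_borel_cs (\<lambda>y. \<bar>h y\<bar>)"
  proof -
    obtain L where "\<And>y. \<bar>h y\<bar> \<le> L" using bounded_borel_bound[OF assms(7)] by metis
    then show ?thesis
      by (intro bounded_borel_csI[where M = L and r = r]) (use r h0 in \<open>auto simp: not_le[symmetric]\<close>)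
  qed
  have hi: "integrable lborel (\<lambda>y. c * \<bar>h y\<bar>)" for c
    using bounded_borel_cs_integrable[OF hcs] by simp
  have "((\<lambda>t. LINT y|lborel. k (x + t *\<^sub>R e - y) * h y) has_real_derivative
        (LINT y|lborel. k' (x + 0 *\<^sub>R e - y) * h y)) (at 0)"
  proof (rule DERIV_integral[OF \<open>d > 0\<close>, where B = "\<lambda>y. M * \<bar>h y\<bar>"])
    fix t assume t: "\<bar>t - 0\<bar> < d"
    show "integrable lborel (\<lambda>y. k (x + t *\<^sub>R e - y) * h y)"
    proof (rule Bochner_Integration.integrable_bound[OF hi[of M0]])
      have "continuous_on S (\<lambda>y. k (x + t *\<^sub>R e - y))"
        by (rule continuous_on_compose2[OF assms(2)]) (use inC t C in \<open>auto intro!: continuous_intros\<close>)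
      then have m: "(\<lambda>y. indicator S y *\<^sub>R k (x + t *\<^sub>R e - y)) \<in> borel_measurable borel"
        using \<open>compact S\<close> by (intro borel_measurable_continuous_on_indicator) (auto simp: compact_imp_closed)
      have "(\<lambda>y. (indicator S y *\<^sub>R k (x + t *\<^sub>R e - y)) * h y) \<in> borel_measurable lborel"
        using borel_measurable_times[OF m, of h] by simp
      also have "(\<lambda>y. (indicator S y *\<^sub>R k (x + t *\<^sub>R e - y)) * h y) = (\<lambda>y. k (x + t *\<^sub>R e - y) * h y)"
        by (intro ext) (auto simp: indicator_def h0)
      finally show "(\<lambda>y. k (x + t *\<^sub>R e - y) * h y) \<in> borel_measurable lborel" .
      have "\<bar>k (x + t *\<^sub>R e - y) * h y\<bar> \<le> \<bar>M0 * \<bar>h y\<bar>\<bar>" for y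
      proof (cases "y \<in> S")
        case True
        then have "\<bar>k (x + t *\<^sub>R e - y)\<bar> \<le> \<bar>M0\<bar>" using M0[OF inC[of y t]] t by auto
        then show ?thesis by (simp add: abs_mult mult_right_mono)
      qed (simp add: h0)
      then show "AE y in lborel. norm (k (x + t *\<^sub>R e - y) * h y) \<le> norm (M0 * \<bar>h y\<bar>)" by simp
    qed
    fix y
    show "((\<lambda>t. k (x + t *\<^sub>R e - y) * h y) has_real_derivative k' (x + t *\<^sub>R e - y) * h y) (at t)"
    proof (cases "y \<in> S")
      case True
      have "((\<lambda>s. k (x - y + t *\<^sub>R e + s *\<^sub>R e)) has_real_derivative k' (x - y + t *\<^sub>R e)) (at 0)"
        using inC[OF True, of t] t C by (intro pd) (auto simp: algebra_simps)
      from DERIV_along_line[OF this] show ?thesis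
        by (intro DERIV_cmult_right) (simp add: algebra_simps)
    qed (simp add: h0)
    show "\<bar>k' (x + t *\<^sub>R e - y) * h y\<bar> \<le> M * \<bar>h y\<bar>"
    proof (cases "y \<in> S")
      case True
      then show ?thesis using M[OF inC[of y t]] t by (auto simp: abs_mult intro!: mult_right_mono)
    qed (simp add: h0)
  qed (rule hi)
  then show ?thesis unfolding conv_def by simp
qed

text \<open>One component of the divergence theorem for fields of bounded support. Convolution of \<open>F\<close> with the indicator of a large ball
  is constant near 0, since it is the translation invariant integral of \<open>F\<close>; its derivative at 0 is the integral of \<open>F'\<close>.\<close>

lemma integral_pderiv_eq_0:
  fixes F F' :: "real^'n::finite \<Rightarrow> real"
  assumes "continuous_on UNIV F" "continuous_on UNIV F'" "norm e = 1"
    and "\<And>u. ((\<lambda>t. F (u + t *\<^sub>R e)) has_real_derivative F' u) (at 0)"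
    and F0: "\<And>u. norm u > r \<Longrightarrow> F u = 0" and F'0: "\<And>u. norm u > r \<Longrightarrow> F' u = 0"
  shows "(LINT y|lborel. F' y) = 0"
proof -
  define h :: "real^'n \<Rightarrow> real" where "h = indicator (cball 0 (r + 1))"
  have cut: "conv G h x = (LINT y|lborel. G y)"
    if "\<And>u. norm u > r \<Longrightarrow> G u = 0" "norm x \<le> 1" for G x
  proof -
    have "G (x - y) * h y = G (x - y)" for y
    proof (cases "norm (x - y) > r")
      case False
      then have "norm y \<le> r + 1" using norm_triangle_sub[of y x] that by (simp add: norm_minus_commute)
      then show ?thesis by (simp add: h_def)
    qed (simp add: that)
    then show ?thesis unfolding conv_def using integral_lborel_reflect[of G x] by presburger
  qed
  have "((\<lambda>t. conv F h (0 + t *\<^sub>R e)) has_real_derivative conv F' h 0) (at 0)"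
  proof (rule conv_has_pderiv[where U = UNIV and S = "cball 0 (r + 1)"])
    show "bounded_borel h" unfolding h_def by (rule bounded_borel_indicator) simp
    show "h y = 0" if "y \<notin> cball 0 (r + 1)" for y using that by (simp add: h_def)
  qed (use assms in auto)
  then have "((\<lambda>t::real. LINT y|lborel. F y) has_real_derivative conv F' h 0) (at 0)"
    by (rule has_field_derivative_transform_within_open[where S = "ball 0 1"])
       (use assms(3) in \<open>auto intro!: cut F0\<close>)
  then have "conv F' h 0 = 0" using DERIV_const DERIV_unique by blast
  then show ?thesis using cut[of F' 0] F'0 by simp
qed

lemma DERIV_norm_powr:
  fixes u y :: "'a::real_inner"
  assumes "u + s *\<^sub>R y \<noteq> 0"
  shows "((\<lambda>t. norm (u + t *\<^sub>R y) powr p) has_real_derivative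
           p * norm (u + s *\<^sub>R y) powr (p - 2) * ((u + s *\<^sub>R y) \<bullet> y)) (at s)"
proof -
  have eq: "norm v powr q = (v \<bullet> v) powr (q / 2)" for v :: 'a and q
    unfolding norm_eq_sqrt_inner by (simp add: powr_half_sqrt[symmetric] powr_powr)
  have pos: "(u + s *\<^sub>R y) \<bullet> (u + s *\<^sub>R y) > 0" using assms by simp
  have "((\<lambda>t. (u + t *\<^sub>R y) \<bullet> (u + t *\<^sub>R y)) has_real_derivative 2 * ((u + s *\<^sub>R y) \<bullet> y)) (at s)"
    by (simp add: inner_simps inner_commute[of y u]) (auto intro!: derivative_eq_intros simp: algebra_simps)
  from DERIV_chain2[OF has_real_derivative_powr[OF pos, of "p/2"] this]
  show ?thesis
    unfolding eq by (rule DERIV_cong) (simp add: diff_divide_distrib)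
qed

section \<open>The mean value property of the Newtonian kernel\<close>

lemma continuous_on_UNIV_by_cover:
  fixes f :: "'a::topological_space \<Rightarrow> 'b::topological_space"
  assumes "open A" "open B" "A \<union> B = UNIV" "continuous_on A f" "continuous_on B f"
  shows "continuous_on UNIV f"
  using continuous_on_open_Un[OF assms(1,2,4,5)] assms(3) by simp

text \<open>A radial kernel satisfies \<open>k(y) y = - grad \<Theta>(y)\<close>, where \<open>\<Theta>(y) = T(|y|^2)\<close>, the derivative of \<open>T\<close> at
  \<open>\<tau>\<close> is \<open>- k(z) / 2\<close> for any \<open>z\<close> with \<open>|z|^2 = \<tau>\<close>, and \<open>T\<close> vanishes beyond \<open>\<rho>^2\<close>. Working with the square of the norm
  avoids a separate discussion at \<open>y = 0\<close>.\<close>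

lemma radial_kernel_potential:
  fixes k :: "real^'n::finite \<Rightarrow> real"
  assumes k: "continuous_on UNIV k" and rad: "\<And>x y. norm x = norm y \<Longrightarrow> k x = k y"
    and k0: "\<And>y. norm y > \<rho> \<Longrightarrow> k y = 0" and "\<rho> \<ge> 0"
  obtains \<Theta> :: "real^'n \<Rightarrow> real" where "continuous_on UNIV \<Theta>" "\<And>y. norm y > \<rho> \<Longrightarrow> \<Theta> y = 0"
    "\<And>y i. ((\<lambda>t. \<Theta> (y + t *\<^sub>R axis i 1)) has_real_derivative - (k y * y $ i)) (at 0)"
proof -
  obtain i0 :: 'n where True by simp
  define j where "j \<tau> = k (sqrt (max \<tau> 0) *\<^sub>R axis i0 1) / 2" for \<tau> :: real
  \<comment> \<open>The upper limit lies strictly beyond \<open>\<rho>^2\<close>, so that points of norm \<open>\<rho>\<close> are interior to the domain of \<open>T\<close>.\<close>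
  define b where "b = \<rho>\<^sup>2 + 1"
  define T where "T \<tau> = integral {\<tau>..b} j" for \<tau>
  have kj: "j (y \<bullet> y) = k y / 2" for y
    unfolding j_def using rad[of "sqrt (max (y \<bullet> y) 0) *\<^sub>R axis i0 1" y]
    by (simp add: norm_eq_sqrt_inner[of y])
  have j_cont: "continuous_on UNIV j"
    unfolding j_def by (intro continuous_intros continuous_on_compose2[OF k]) auto
  have T0: "T \<tau> = 0" if "\<tau> \<ge> \<rho>\<^sup>2" for \<tau>
  proof -
    have "j t = 0" if "t \<in> {\<tau><..b}" for t
    proof -
      have t: "\<rho>\<^sup>2 < t" using that \<open>\<tau> \<ge> \<rho>\<^sup>2\<close> by auto
      then have "\<rho> < sqrt t" by (rule real_less_rsqrt)
      moreover have "0 \<le> t" using t zero_le_power2[of \<rho>] by linarith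
      ultimately show ?thesis unfolding j_def by (simp add: k0)
    qed
    then have "T \<tau> = integral {\<tau>..b} (\<lambda>_. 0)"
      unfolding T_def by (intro integral_spike[of "{\<tau>}"]) auto
    then show ?thesis by simp
  qed
  have T_der: "(T has_real_derivative - j \<tau>) (at \<tau>)" if "\<tau> \<ge> 0" "\<tau> < b" for \<tau>
  proof -
    have "(T has_real_derivative - j \<tau>) (at \<tau> within {-1..b})"
      unfolding T_def using that
      by (intro integral_has_real_derivative' continuous_on_subset[OF j_cont]) auto
    moreover have "at \<tau> within {-1..b} = at \<tau>"
      using that by (intro at_within_interior) (auto simp: interior_atLeastAtMost_real)
    ultimately show ?thesis by simp
  qed
  define \<Theta> where "\<Theta> y = T (y \<bullet> y)" for y :: "real^'n"
  have \<Theta>0: "\<Theta> y = 0" if "norm y > \<rho>" for y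
    unfolding \<Theta>_def using that \<open>\<rho> \<ge> 0\<close>
    by (intro T0) (simp add: power2_norm_eq_inner[symmetric] power_mono)
  have cover: "y \<bullet> y < b \<or> norm y > \<rho>" for y :: "real^'n"
  proof (cases "norm y > \<rho>")
    case False
    then have "(norm y)\<^sup>2 \<le> \<rho>\<^sup>2" by (intro power_mono) auto
    then show ?thesis unfolding b_def by (simp add: power2_norm_eq_inner)
  qed simp
  have \<Theta>_cont: "continuous_on UNIV \<Theta>"
  proof (rule continuous_on_UNIV_by_cover)
    show "open {y::real^'n. y \<bullet> y < b}" by (intro open_Collect_less continuous_intros)
    show "open {y::real^'n. norm y > \<rho>}" by (intro open_Collect_less continuous_intros)
    show "{y::real^'n. y \<bullet> y < b} \<union> {y. norm y > \<rho>} = UNIV" using cover by auto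
    have "isCont T \<tau>" if "\<tau> \<ge> 0" "\<tau> < b" for \<tau>
      using T_der[OF that] by (rule DERIV_isCont)
    then have "continuous_on {0..<b} T"
      by (intro continuous_at_imp_continuous_on ballI) simp
    then show "continuous_on {y. y \<bullet> y < b} \<Theta>"
      unfolding \<Theta>_def by (rule continuous_on_compose2) (auto intro!: continuous_intros)
    show "continuous_on {y. norm y > \<rho>} \<Theta>"
      by (rule continuous_on_eq[OF continuous_on_const[of _ 0]]) (simp add: \<Theta>0)
  qed
  have "((\<lambda>t. \<Theta> (y + t *\<^sub>R axis i 1)) has_real_derivative - (k y * y $ i)) (at 0)" for y i
  proof (cases "norm y > \<rho>")
    case True
    have "((\<lambda>t. 0) has_real_derivative 0) (at (0::real))" by simp
    then have "((\<lambda>t. \<Theta> (y + t *\<^sub>R axis i 1)) has_real_derivative 0) (at 0)"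
    proof (rule has_field_derivative_transform_within_open)
      show "open {t. norm (y + t *\<^sub>R axis i 1) > \<rho>}" by (intro open_Collect_less continuous_intros)
    qed (use True \<Theta>0 in auto)
    then show ?thesis using k0[OF True] by simp
  next
    case False
    then have "y \<bullet> y < b" using cover by blast
    then have "(T has_real_derivative - j (y \<bullet> y)) (at ((y + 0 *\<^sub>R axis i 1) \<bullet> (y + 0 *\<^sub>R axis i 1)))"
      using T_der[of "y \<bullet> y"] by simp
    moreover have "((\<lambda>t. (y + t *\<^sub>R axis i 1) \<bullet> (y + t *\<^sub>R axis i 1)) has_real_derivative 2 * y $ i) (at 0)"
    proof -
      have "(y + t *\<^sub>R axis i 1) \<bullet> (y + t *\<^sub>R axis i 1) = y \<bullet> y + 2 * t * y $ i + t * t" for t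
        unfolding inner_add_left inner_add_right inner_scaleR_left inner_scaleR_right inner_axis_axis
          inner_commute[of "axis i 1" y] inner_axis by (simp add: distrib_left)
      then show ?thesis by (auto intro!: derivative_eq_intros)
    qed
    ultimately have "((\<lambda>t. \<Theta> (y + t *\<^sub>R axis i 1)) has_real_derivative - j (y \<bullet> y) * (2 * y $ i)) (at 0)"
      unfolding \<Theta>_def by (rule DERIV_chain2)
    then show ?thesis by (simp add: kj)
  qed
  with \<Theta>_cont \<Theta>0 show thesis by (rule that)
qed

text \<open>Up to a factor, the integral is the derivative in \<open>r\<close> of the \<open>k\<close>-average of \<open>|.|^(2-N)\<close> over the points \<open>x + r y\<close>. Since
  \<open>k(y) y = - grad \<Theta>(y)\<close> and the field \<open>u |u|^(-N)\<close> is divergence free, the integrand is the negative divergence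
  of \<open>V(y) = \<Theta>(y) u |u|^(-N)\<close> with \<open>u = x + r y\<close>. The singularity \<open>u = 0\<close> is harmless because it lies outside
  the support of \<open>\<Theta>\<close>.\<close>

lemma radial_flux_eq_0:
  fixes k :: "real^'n::finite \<Rightarrow> real" and x :: "real^'n"
  defines "N \<equiv> real CARD('n)"
  assumes k: "continuous_on UNIV k" and rad: "\<And>x y. norm x = norm y \<Longrightarrow> k x = k y"
    and k0: "\<And>y. norm y > \<rho> \<Longrightarrow> k y = 0" and "\<rho> \<ge> 0" and r: "\<bar>r\<bar> * \<rho> < norm x"
  shows "(LINT y|lborel. k y * (norm (x + r *\<^sub>R y) powr (- N) * ((x + r *\<^sub>R y) \<bullet> y))) = 0"
proof -
  obtain \<Theta> :: "real^'n \<Rightarrow> real" where \<Theta>: "continuous_on UNIV \<Theta>" "\<And>y. norm y > \<rho> \<Longrightarrow> \<Theta> y = 0"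
    "\<And>y i. ((\<lambda>t. \<Theta> (y + t *\<^sub>R axis i 1)) has_real_derivative - (k y * y $ i)) (at 0)"
    using radial_kernel_potential[OF k rad k0 \<open>\<rho> \<ge> 0\<close>] by blast
  define u where "u y = x + r *\<^sub>R y" for y
  have u_nz: "u y \<noteq> 0" if "norm y \<le> \<rho>" for y
  proof
    assume "u y = 0"
    then have "norm x = \<bar>r\<bar> * norm y"
      unfolding u_def by (metis add_eq_0_iff2 norm_minus_cancel norm_scaleR)
    also have "\<dots> \<le> \<bar>r\<bar> * \<rho>" using that by (intro mult_left_mono) auto
    finally show False using r by simp
  qed
  define V where "V i y = \<Theta> y * (norm (u y) powr (- N) * u y $ i)" for i y
  define D where "D i y = - (k y * y $ i) * (norm (u y) powr (- N) * u y $ i)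
     + \<Theta> y * r * (norm (u y) powr (- N) - N * (norm (u y) powr (- N - 2) * (u y $ i)\<^sup>2))" for i y
  have V0: "V i y = 0" and D0: "D i y = 0" if "norm y > \<rho>" for i y
    unfolding V_def D_def using that k0 \<Theta>(2) by auto
  have cover: "{y. norm y > \<rho>} \<union> {y. u y \<noteq> 0} = UNIV" using u_nz by force
  have op: "open {y::real^'n. norm y > \<rho>}" "open {y. u y \<noteq> 0}"
    unfolding u_def by (intro open_Collect_less open_Collect_neq continuous_intros)+
  have V_cont: "continuous_on UNIV (V i)" for i
  proof (rule continuous_on_UNIV_by_cover[OF op cover])
    show "continuous_on {y. norm y > \<rho>} (V i)"
      by (rule continuous_on_eq[OF continuous_on_const[of _ 0]]) (simp add: V0)
    show "continuous_on {y. u y \<noteq> 0} (V i)"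
      unfolding V_def u_def
      by (intro continuous_intros continuous_on_subset[OF \<Theta>(1)]) auto
  qed
  have D_cont: "continuous_on UNIV (D i)" for i
  proof (rule continuous_on_UNIV_by_cover[OF op cover])
    show "continuous_on {y. norm y > \<rho>} (D i)"
      by (rule continuous_on_eq[OF continuous_on_const[of _ 0]]) (simp add: D0)
    show "continuous_on {y. u y \<noteq> 0} (D i)"
      unfolding D_def u_def
      by (intro continuous_intros continuous_on_subset[OF \<Theta>(1)] continuous_on_subset[OF k]) auto
  qed
  have V_der: "((\<lambda>t. V i (y + t *\<^sub>R axis i 1)) has_real_derivative D i y) (at 0)" for i y
  proof (cases "norm y > \<rho>")
    case True
    have "((\<lambda>t. 0) has_real_derivative 0) (at (0::real))" by simp
    then have "((\<lambda>t. V i (y + t *\<^sub>R axis i 1)) has_real_derivative 0) (at 0)"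
    proof (rule has_field_derivative_transform_within_open)
      show "open {t. norm (y + t *\<^sub>R axis i 1) > \<rho>}" by (intro open_Collect_less continuous_intros)
    qed (use True V0 in auto)
    then show ?thesis using D0[OF True] by simp
  next
    case False
    then have nz: "u y \<noteq> 0" using u_nz by simp
    have ut: "u (y + t *\<^sub>R axis i 1) = u y + t *\<^sub>R (r *\<^sub>R axis i 1)" for t
      unfolding u_def by (simp add: algebra_simps)
    have 1: "((\<lambda>t. norm (u (y + t *\<^sub>R axis i 1)) powr (- N)) has_real_derivative
        - N * (norm (u y) powr (- N - 2) * (r * u y $ i))) (at 0)"
      unfolding ut
      by (rule DERIV_cong[OF DERIV_norm_powr]) (use nz in \<open>auto simp: inner_axis\<close>)
    have 2: "((\<lambda>t. u (y + t *\<^sub>R axis i 1) $ i) has_real_derivative r) (at 0)"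
      unfolding ut by (auto intro!: derivative_eq_intros simp: axis_def)
    have "((\<lambda>t. V i (y + t *\<^sub>R axis i 1)) has_real_derivative
        - (k y * y $ i) * (norm (u y) powr (- N) * u y $ i)
        + (- N * (norm (u y) powr (- N - 2) * (r * u y $ i)) * u y $ i + r * norm (u y) powr (- N)) * \<Theta> y) (at 0)"
      unfolding V_def using DERIV_mult[OF \<Theta>(3)[of y i] DERIV_mult[OF 1 2]] by simp
    then show ?thesis
      by (rule DERIV_cong) (simp add: D_def algebra_simps power2_eq_square)
  qed
  have D_int: "integrable lborel (D i)" for i
    by (intro bounded_borel_cs_integrable continuous_cs_bounded_borel_cs[OF D_cont D0])
  have sum_D: "(\<Sum>i\<in>UNIV. D i y) = - (k y * (norm (u y) powr (- N) * (u y \<bullet> y)))" for y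
  proof (cases "u y = 0")
    case True
    then have "norm y > \<rho>" using u_nz not_le by blast
    then show ?thesis using D0 True by simp
  next
    case False
    have sq: "(\<Sum>i\<in>UNIV. (u y $ i)\<^sup>2) = (norm (u y))\<^sup>2"
      by (simp add: norm_vec_def L2_set_def sum_nonneg)
    have "norm (u y) powr (- N - 2) * (norm (u y))\<^sup>2 = norm (u y) powr (- N)"
      using False by (simp add: powr_diff)
    moreover have "(\<Sum>i\<in>UNIV. norm (u y) powr (- N) - N * (norm (u y) powr (- N - 2) * (u y $ i)\<^sup>2))
        = N * norm (u y) powr (- N) - N * (norm (u y) powr (- N - 2) * (\<Sum>i\<in>UNIV. (u y $ i)\<^sup>2))"
      by (simp add: sum_subtractf sum_distrib_left N_def)
    ultimately have "(\<Sum>i\<in>UNIV. norm (u y) powr (- N) - N * (norm (u y) powr (- N - 2) * (u y $ i)\<^sup>2)) = 0"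
      by (simp add: sq)
    moreover have "(\<Sum>i\<in>UNIV. D i y) = - (k y * (norm (u y) powr (- N) * (\<Sum>i\<in>UNIV. u y $ i * y $ i)))
       + \<Theta> y * r * (\<Sum>i\<in>UNIV. norm (u y) powr (- N) - N * (norm (u y) powr (- N - 2) * (u y $ i)\<^sup>2))"
      unfolding D_def sum.distrib sum_distrib_left sum_negf[symmetric]
      by (intro arg_cong2[where f = "(+)"] sum.cong) (auto simp: algebra_simps)
    ultimately show ?thesis by (simp add: inner_vec_def)
  qed
  have "(LINT y|lborel. (\<Sum>i\<in>UNIV. D i y)) = (\<Sum>i\<in>UNIV. LINT y|lborel. D i y)"
    by (intro Bochner_Integration.integral_sum D_int)
  also have "\<dots> = 0"
    by (intro sum.neutral ballI integral_pderiv_eq_0[OF V_cont D_cont _ V_der V0 D0]) auto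
  finally show ?thesis unfolding sum_D u_def by simp
qed

text \<open>The \<open>k\<close>-average \<open>F(t)\<close> of \<open>E\<close> over the points \<open>x + t y\<close> does not depend on \<open>t\<close> between 0 and 1, because its derivative is a
  vanishing flux. At \<open>t = 0\<close> it is the right-hand side, at \<open>t = 1\<close> the convolution.\<close>

lemma mean_value_newton_kernel:
  fixes k :: "real^'n::finite \<Rightarrow> real"
  defines "E \<equiv> \<lambda>y::real^'n. norm y powr (2 - real CARD('n))"
  assumes N: "CARD('n) \<ge> 2" and k: "continuous_on UNIV k"
    and rad: "\<And>x y. norm x = norm y \<Longrightarrow> k x = k y"
    and k0: "\<And>y. norm y > \<rho> \<Longrightarrow> k y = 0" and "\<rho> \<ge> 0" and x: "norm x > \<rho>"
  shows "conv k E x = (LINT y|lborel. k y) * E x"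
proof -
  define p where "p = 2 - real CARD('n)"
  have p: "p \<le> 0" using N unfolding p_def by simp
  have kcs: "bounded_borel_cs k" by (rule continuous_cs_bounded_borel_cs[OF k k0])
  have [measurable]: "k \<in> borel_measurable borel"
    using kcs bounded_borel_cs_imp bounded_borel_measurable by blast
  obtain K where K: "\<And>y. \<bar>k y\<bar> \<le> K" using bounded_borel_bound[OF bounded_borel_cs_imp[OF kcs]] by metis
  define G where "G t y = k y * norm (x + t *\<^sub>R y) powr p" for t y
  define G' where "G' t y = k y * (p * norm (x + t *\<^sub>R y) powr (p - 2) * ((x + t *\<^sub>R y) \<bullet> y))" for t y
  define F where "F t = (LINT y|lborel. G t y)" for t
  have "(F has_real_derivative 0) (at t0 within {0..1})" if t0: "t0 \<in> {0..1}" for t0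
  proof -
    \<comment> \<open>Small enough to keep \<open>x + t y\<close> at distance at least \<open>m\<close> from 0 for \<open>|t - t0| < \<delta>\<close> and \<open>|y| \<le> \<rho>\<close>.\<close>
    define \<delta> where "\<delta> = (norm x - \<rho>) / (2 * (\<rho> + 1))"
    have "\<delta> > 0" unfolding \<delta>_def using x \<open>\<rho> \<ge> 0\<close> by simp
    have "\<delta> * \<rho> \<le> \<delta> * (\<rho> + 1)" using \<open>\<delta> > 0\<close> by simp
    also have "\<dots> = (norm x - \<rho>) / 2" unfolding \<delta>_def using \<open>\<rho> \<ge> 0\<close> by (simp add: field_simps)
    finally have d\<rho>: "\<delta> * \<rho> \<le> (norm x - \<rho>) / 2" .
    define m where "m = (norm x - \<rho>) / 2"
    have "m > 0" unfolding m_def using x by simp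
    have ty: "\<bar>t\<bar> * \<rho> \<le> norm x - m" if "\<bar>t - t0\<bar> < \<delta>" for t
    proof -
      have "\<bar>t\<bar> \<le> 1 + \<delta>" using that t0 by auto
      then have "\<bar>t\<bar> * \<rho> \<le> (1 + \<delta>) * \<rho>" using \<open>\<rho> \<ge> 0\<close> by (rule mult_right_mono)
      also have "\<dots> \<le> norm x - m" using d\<rho> unfolding m_def by (simp add: distrib_right field_simps)
      finally show ?thesis .
    qed
    have low: "m \<le> norm (x + t *\<^sub>R y)" and up: "norm (x + t *\<^sub>R y) \<le> 2 * norm x"
      if "\<bar>t - t0\<bar> < \<delta>" "norm y \<le> \<rho>" for t y
    proof -
      have "norm (t *\<^sub>R y) \<le> \<bar>t\<bar> * \<rho>" using that(2) by (simp add: mult_left_mono)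
      then have "norm (t *\<^sub>R y) \<le> norm x - m" using ty[OF that(1)] by linarith
      then show "m \<le> norm (x + t *\<^sub>R y)" "norm (x + t *\<^sub>R y) \<le> 2 * norm x"
        using norm_diff_ineq[of x "t *\<^sub>R y"] norm_triangle_ineq[of x "t *\<^sub>R y"] \<open>m > 0\<close> by linarith+
    qed
    have Gcs: "bounded_borel_cs (G t)" if "\<bar>t - t0\<bar> < \<delta>" for t
    proof (rule bounded_borel_csI[where r = \<rho>])
      show "G t \<in> borel_measurable borel" unfolding G_def by measurable
      show "\<bar>G t y\<bar> \<le> K * m powr p" for y
      proof (cases "norm y \<le> \<rho>")
        case True
        have "norm (x + t *\<^sub>R y) powr p \<le> m powr p"
          using low[OF that True] \<open>m > 0\<close> p by (intro powr_mono2') auto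
        then show ?thesis unfolding G_def abs_mult using K[of y] by (intro mult_mono) auto
      next
        case False
        then show ?thesis using k0[of y] K[of 0] by (simp add: G_def)
      qed
      show "G t y = 0" if "norm y > \<rho>" for y using k0[OF that] by (simp add: G_def)
    qed
    define B where "B y = \<bar>k y\<bar> * (\<bar>p\<bar> * m powr (p - 2) * (2 * norm x * \<rho>))" for y
    have "(F has_real_derivative (LINT y|lborel. G' t0 y)) (at t0)"
      unfolding F_def
    proof (rule DERIV_integral[OF \<open>\<delta> > 0\<close>, where B = B])
      fix t assume t: "\<bar>t - t0\<bar> < \<delta>"
      show "integrable lborel (G t)" by (rule bounded_borel_cs_integrable[OF Gcs[OF t]])
      fix y
      show "((\<lambda>t. G t y) has_real_derivative G' t y) (at t)"
      proof (cases "norm y \<le> \<rho>")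
        case True
        then have "x + t *\<^sub>R y \<noteq> 0" using low[OF t True] \<open>m > 0\<close> by auto
        from DERIV_cmult[OF DERIV_norm_powr[OF this, of p], of "k y"]
        show ?thesis unfolding G_def G'_def .
      qed (simp add: G_def G'_def k0)
      show "\<bar>G' t y\<bar> \<le> B y"
      proof (cases "norm y \<le> \<rho>")
        case True
        have "norm (x + t *\<^sub>R y) powr (p - 2) \<le> m powr (p - 2)"
          using low[OF t True] \<open>m > 0\<close> p by (intro powr_mono2') auto
        moreover have "\<bar>(x + t *\<^sub>R y) \<bullet> y\<bar> \<le> 2 * norm x * \<rho>"
        proof -
          have "\<bar>(x + t *\<^sub>R y) \<bullet> y\<bar> \<le> norm (x + t *\<^sub>R y) * norm y" by (rule Cauchy_Schwarz_ineq2)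
          also have "\<dots> \<le> 2 * norm x * \<rho>" using up[OF t True] True by (intro mult_mono) auto
          finally show ?thesis .
        qed
        ultimately show ?thesis unfolding G'_def B_def abs_mult
          by (intro mult_mono mult_nonneg_nonneg) auto
      qed (simp add: G'_def B_def k0)
    next
      show "integrable lborel B"
        unfolding B_def using bounded_borel_cs_integrable[OF kcs] by simp
    qed
    moreover have "(LINT y|lborel. G' t0 y) = 0"
    proof -
      have "\<bar>t0\<bar> * \<rho> < norm x" using ty[of t0] \<open>\<delta> > 0\<close> \<open>m > 0\<close> by simp
      from radial_flux_eq_0[OF k rad k0 \<open>\<rho> \<ge> 0\<close> this]
      have "(LINT y|lborel. p * (k y * (norm (x + t0 *\<^sub>R y) powr (- real CARD('n)) * ((x + t0 *\<^sub>R y) \<bullet> y)))) = 0"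
        by simp
      then show ?thesis unfolding G'_def p_def by (simp add: algebra_simps)
    qed
    ultimately show ?thesis by (simp add: has_field_derivative_at_within)
  qed
  then obtain c where "\<And>t. t \<in> {0..1} \<Longrightarrow> F t = c"
    using has_field_derivative_zero_constant[of "{0..1::real}" F] by auto
  then have "F 1 = F 0" by simp
  moreover have "F 0 = (LINT y|lborel. k y) * E x" unfolding F_def G_def E_def p_def by simp
  moreover have "F 1 = conv k E x"
  proof -
    have "conv k E x = conv E k x" by (simp add: conv_commute)
    also have "\<dots> = (LINT y|lborel. E (x - (0 - y)) * k (0 - y))"
      unfolding conv_def using integral_lborel_reflect[of "\<lambda>y. E (x - y) * k y" 0] by simp
    also have "\<dots> = F 1"
      unfolding F_def G_def E_def p_def using rad[of "- y" y for y] by (simp add: mult.commute)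
    finally show ?thesis by simp
  qed
  ultimately show ?thesis by simp
qed

section \<open>Continuity and rotation invariance of convolutions\<close>

text \<open>This gives the continuity of \<open>J * \<phi>\<close> when nothing but local integrability is known of \<open>\<phi>\<close>, and hence makes
  \<open>\<phi>\<close> a bounded Borel function.\<close>

lemma continuous_convol:
  fixes k f :: "real^'n::finite \<Rightarrow> real"
  assumes k: "continuous_on UNIV k" and k0: "\<And>y. norm y > r \<Longrightarrow> k y = 0" and f: "locally_integrable f"
  shows "continuous_on UNIV (convol k f)"
proof -
  obtain M where M: "\<And>y. \<bar>k y\<bar> \<le> M"
    using bounded_borel_bound[OF bounded_borel_cs_imp[OF continuous_cs_bounded_borel_cs[OF k k0]]] by metis
  have "isCont (convol k f) x" for x
    unfolding continuous_at_sequentially comp_def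
  proof (intro allI impI)
    fix X :: "nat \<Rightarrow> real^'n" assume X: "X \<longlonglongrightarrow> x"
    obtain B where B: "\<And>n. norm (X n) \<le> B"
      using convergent_imp_Bseq[OF convergentI[OF X]] unfolding Bseq_def by blast
    have Bx: "norm x \<le> B"
      by (rule Lim_norm_ubound[OF trivial_limit_sequentially X]) (simp add: B)
    define g where "g y = indicat_real (cball 0 (B + r)) y *\<^sub>R f y" for y
    have g: "integrable lebesgue g"
    proof -
      have "f absolutely_integrable_on cball 0 (B + r)"
        using f compact_cball unfolding locally_integrable_def by blast
      then show ?thesis unfolding set_integrable_def g_def .
    qed
    have cut: "k (z - y) * f y = k (z - y) * g y" if "norm z \<le> B" for z y
    proof (cases "norm (z - y) > r")
      case False
      then have "norm y \<le> B + r" using norm_triangle_sub[of y z] that by (simp add: norm_minus_commute)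
      then show ?thesis by (simp add: g_def)
    qed (simp add: k0)
    have km: "(\<lambda>y. k (z - y)) \<in> borel_measurable lebesgue" for z
      proof -
      have "continuous_on UNIV (\<lambda>y. k (z - y))"
        by (rule continuous_on_compose2[OF k]) (auto intro!: continuous_intros)
      then show ?thesis by (intro measurable_completion) (simp add: borel_measurable_continuous_onI)
    qed
    have "(\<lambda>n. LINT y|lebesgue. k (X n - y) * g y) \<longlonglongrightarrow> (LINT y|lebesgue. k (x - y) * g y)"
    proof (rule integral_dominated_convergence[where w = "\<lambda>y. M * \<bar>g y\<bar>"])
      show "integrable lebesgue (\<lambda>y. M * \<bar>g y\<bar>)" using g by simp
      show "(\<lambda>y. k (z - y) * g y) \<in> borel_measurable lebesgue" for z
        using km g by (intro borel_measurable_times) auto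
      then show "(\<lambda>y. k (X n - y) * g y) \<in> borel_measurable lebesgue" for n .
      show "AE y in lebesgue. (\<lambda>n. k (X n - y) * g y) \<longlonglongrightarrow> k (x - y) * g y"
      proof (rule AE_I2)
        fix y
        have "isCont k (x - y)" using k by (simp add: continuous_on_eq_continuous_at)
        then have "(\<lambda>n. k (X n - y)) \<longlonglongrightarrow> k (x - y)"
          by (rule isCont_tendsto_compose) (intro tendsto_diff X tendsto_const)
        then show "(\<lambda>n. k (X n - y) * g y) \<longlonglongrightarrow> k (x - y) * g y"
          by (intro tendsto_mult tendsto_const)
      qed
      show "AE y in lebesgue. norm (k (X n - y) * g y) \<le> M * \<bar>g y\<bar>" for n
        using M by (intro AE_I2) (simp add: abs_mult mult_right_mono)
    qed
    then show "(\<lambda>n. convol k f (X n)) \<longlonglongrightarrow> convol k f x"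
      unfolding convol_def cut[OF B] cut[OF Bx] .
  qed
  then show ?thesis by (simp add: continuous_at_imp_continuous_on)
qed

lemma bounded_borel_locally_integrable:
  assumes "bounded_borel f" shows "locally_integrable f"
  unfolding locally_integrable_def set_integrable_def
proof (intro allI impI)
  fix K :: "(real^'a) set" assume K: "compact K"
  obtain M where M: "\<And>y. \<bar>f y\<bar> \<le> M" using bounded_borel_bound[OF assms] by metis
  obtain r where r: "\<And>y. y \<in> K \<Longrightarrow> norm y \<le> r" using compact_imp_bounded[OF K] unfolding bounded_iff by blast
  have "bounded_borel_cs (\<lambda>y. indicat_real K y *\<^sub>R f y)"
  proof (rule bounded_borel_csI[where M = M and r = r])
    show "(\<lambda>y. indicat_real K y *\<^sub>R f y) \<in> borel_measurable borel"
      using K bounded_borel_measurable[OF assms]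
      by (intro borel_measurable_scaleR borel_measurable_indicator) (auto simp: compact_imp_closed)
    show "\<bar>indicat_real K y *\<^sub>R f y\<bar> \<le> M" for y using M[of y] by (auto simp: indicator_def)
  qed (use r in \<open>force simp: indicator_def\<close>)
  then show "integrable lebesgue (\<lambda>y. indicat_real K y *\<^sub>R f y)"
    using bounded_borel_cs_integrable bounded_borel_measurable[OF bounded_borel_cs_imp]
    by (subst integrable_completion) auto
qed

lemma convol_eq_conv:
  assumes "k \<in> borel_measurable borel" "f \<in> borel_measurable borel"
  shows "convol k f = conv k f"
proof
  fix x
  have [measurable]: "k \<in> borel_measurable borel" "f \<in> borel_measurable borel" by fact+
  show "convol k f x = conv k f x"
    unfolding convol_def conv_def by (rule integral_completion) measurable
qed

lemma continuous_conv:
  fixes k f :: "real^'n::finite \<Rightarrow> real"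
  assumes "continuous_on UNIV k" "\<And>y. norm y > r \<Longrightarrow> k y = 0" "bounded_borel f"
  shows "continuous_on UNIV (conv k f)"
  using continuous_convol[OF assms(1,2) bounded_borel_locally_integrable[OF assms(3)]]
    convol_eq_conv[OF borel_measurable_continuous_onI[OF assms(1)] bounded_borel_measurable[OF assms(3)]]
  by simp

lemma distr_lborel_orthogonal:
  fixes T :: "real^'n::{finite,wellorder} \<Rightarrow> real^'n::_"
  assumes T: "orthogonal_transformation T"
  shows "distr lborel borel T = lborel"
proof -
  have Tm: "T \<in> borel_measurable borel"
    using T by (intro borel_measurable_continuous_onI linear_continuous_on)
      (simp add: orthogonal_transformation_linear linear_conv_bounded_linear[symmetric])
  have "lborel = distr lborel borel T"
  proof (rule lborel_eqI)
    fix l u :: "(real, 'n) vec"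
    assume lu: "\<And>b. b \<in> Basis \<Longrightarrow> l \<bullet> b \<le> u \<bullet> b"
    have pre: "T -` box l u = inv T ` box l u"
      using orthogonal_transformation_bij[OF T] by (simp add: bij_vimage_eq_inv_image)
    have iT: "orthogonal_transformation (inv T)" by (rule orthogonal_transformation_inv[OF T])
    have m: "T -` box l u \<in> sets borel" using measurable_sets[OF Tm, of "box l u"] by simp
    have lm: "inv T ` box l u \<in> lmeasurable"
      by (rule measurable_orthogonal_image[OF iT]) simp
    have "emeasure (distr lborel borel T) (box l u) = emeasure lborel (T -` box l u)"
      using Tm by (subst emeasure_distr) auto
    also have "\<dots> = emeasure lebesgue (T -` box l u)" using m by simp
    also have "\<dots> = ennreal (measure lebesgue (inv T ` box l u))"
      unfolding pre using lm by (rule emeasure_eq_measure2)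
    also have "\<dots> = ennreal (measure lebesgue (box l u))"
      by (simp add: measure_orthogonal_image[OF iT])
    also have "\<dots> = emeasure lebesgue (box l u)" by (rule emeasure_eq_measure2[symmetric]) simp
    also have "\<dots> = (\<Prod>b\<in>Basis. (u - l) \<bullet> b)" using lu by simp
    finally show "emeasure (distr lborel borel T) (box l u) = (\<Prod>b\<in>Basis. (u - l) \<bullet> b)" .
  qed simp
  then show ?thesis by simp
qed

text \<open>Rotate \<open>y\<close> to \<open>x\<close> by an orthogonal map, which preserves Lebesgue measure.\<close>

lemma conv_radial:
  fixes k f :: "real^'n::{finite,wellorder} \<Rightarrow> real"
  assumes k: "\<And>x y. norm x = norm y \<Longrightarrow> k x = k y" and f: "\<And>x y. norm x = norm y \<Longrightarrow> f x = f y"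
    and [measurable]: "k \<in> borel_measurable borel" "f \<in> borel_measurable borel"
    and xy: "norm x = norm y"
  shows "conv k f x = conv k f y"
proof -
  obtain T where T: "orthogonal_transformation T" "T y = x"
    using orthogonal_transformation_exists[of y x] xy by metis
  have Tm: "T \<in> borel_measurable borel"
    using T by (intro borel_measurable_continuous_onI linear_continuous_on)
      (simp add: orthogonal_transformation_linear linear_conv_bounded_linear[symmetric])
  have "conv k f x = (LINT z|distr lborel borel T. k (x - z) * f z)"
    unfolding conv_def by (simp add: distr_lborel_orthogonal[OF T(1)])
  also have "\<dots> = (LINT z|lborel. k (x - T z) * f (T z))"
    by (rule integral_distr) (use Tm in measurable)
  also have "\<dots> = (LINT z|lborel. k (y - z) * f z)"
  proof (rule Bochner_Integration.integral_cong[OF refl])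
    fix z
    have "x - T z = T (y - z)"
      using T(2) linear_diff[OF orthogonal_transformation_linear[OF T(1)]] by simp
    then have "norm (x - T z) = norm (y - z)" by (simp add: orthogonal_transformation_norm[OF T(1)])
    then show "k (x - T z) * f (T z) = k (y - z) * f z"
      using k[of "x - T z" "y - z"] f[of "T z" z] by (simp add: orthogonal_transformation_norm[OF T(1)])
  qed
  finally show ?thesis by (simp add: conv_def)
qed

lemma conv_left_commute:
  assumes "bounded_borel_cs k" "bounded_borel_cs l" "bounded_borel f"
  shows "conv k (conv l f) = conv l (conv k f)"
  using conv_assoc[OF assms] conv_assoc[OF assms(2,1,3)] conv_commute[of k l] by simp

section \<open>Functions averaged by a jump kernel\<close>

text \<open>The density of a random jump of length at most 1 whose law is invariant under rotations.\<close>

locale jump_kernel =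
  fixes J :: "(real, 'n::{finite,wellorder}) vec \<Rightarrow> real"
  assumes dim: "CARD('n) \<ge> 3"
    and J_cont: "continuous_on UNIV J"
    and J_nonneg: "0 \<le> J x"
    and J_radial: "norm x = norm y \<Longrightarrow> J x = J y"
    and J_support: "norm x > 1 \<Longrightarrow> J x = 0"
    and J_0: "0 < J 0"
    and J_mass: "(LINT x|lborel. J x) = 1"
begin

lemma J_cs: "bounded_borel_cs J"
  by (rule continuous_cs_bounded_borel_cs[OF J_cont J_support])

lemma J_measurable: "J \<in> borel_measurable borel"
  by (rule borel_measurable_continuous_onI[OF J_cont])

lemma J_pos_ball: obtains r where "0 < r" "\<And>x. norm x < r \<Longrightarrow> 0 < J x"
proof -
  have "open {x. 0 < J x}" by (rule open_Collect_less[OF continuous_on_const J_cont])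
  then obtain r where "r > 0" "ball 0 r \<subseteq> {x. 0 < J x}"
    using J_0 unfolding open_contains_ball by blast
  then show thesis by (intro that[of r]) auto
qed

lemma conv_J_const: "conv J (\<lambda>_. c) x = c"
  by (simp add: conv_const J_mass)

text \<open>The strong maximum principle: at a positive maximum the \<open>J\<close>-average of the nonnegative function \<open>M - q\<close> is 0, so the set
  where \<open>q = M\<close> is open as well as closed, and \<open>q\<close> would be a positive constant.\<close>

lemma J_averaged_le_0:
  assumes "bounded_borel q" "\<And>x. conv J q x = q x" "(q \<longlongrightarrow> 0) at_infinity"
  shows "q x \<le> 0"
proof (rule ccontr)
  assume "\<not> q x \<le> 0"
  then have qx: "q x > 0" by simp
  have q_cont: "continuous_on UNIV q"
    using continuous_conv[OF J_cont J_support assms(1)] assms(2) by (simp add: fun_eq_iff[symmetric] ext)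
  obtain b where b: "\<And>y. norm y \<ge> b \<Longrightarrow> \<bar>q y\<bar> < q x"
    using assms(3) qx unfolding tendsto_iff eventually_at_infinity dist_real_def by fastforce
  have "x \<in> cball 0 b" using b[of x] by (cases "norm x \<ge> b") auto
  then obtain z where z: "z \<in> cball 0 b" "\<And>y. y \<in> cball 0 b \<Longrightarrow> q y \<le> q z"
    using continuous_attains_sup[of "cball 0 b" q] continuous_on_subset[OF q_cont]
    by (metis compact_cball empty_iff subset_UNIV)
  define M where "M = q z"
  have "q x \<le> M" using z(2) \<open>x \<in> cball 0 b\<close> unfolding M_def by blast
  have M: "q y \<le> M" for y
  proof (cases "norm y \<le> b")
    case True then show ?thesis using z(2)[of y] unfolding M_def by simp
  next
    case False then show ?thesis using b[of y] \<open>q x \<le> M\<close> by auto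
  qed
  obtain r where r: "0 < r" "\<And>x. norm x < r \<Longrightarrow> 0 < J x" using J_pos_ball by blast
  have step: "q v = M" if "q u = M" "dist u v < r" for u v
  proof (rule ccontr)
    assume "q v \<noteq> M"
    then have "0 < J (u - v) * (M - q v)" using r(2)[of "u - v"] that(2) M[of v] by (simp add: dist_norm)
    moreover have "continuous_on UNIV (\<lambda>y. J (u - y) * (M - q y))"
      by (intro continuous_intros q_cont continuous_on_compose2[OF J_cont]) auto
    moreover have "integrable lborel (\<lambda>y. J (u - y) * (M - q y))"
      by (rule conv_integrable[OF J_cs bounded_borel_diff[OF bounded_borel_const assms(1)]])
    ultimately have "0 < conv J (\<lambda>y. M - q y) u"
      unfolding conv_def using J_nonneg M by (intro integral_pos_of_continuous[where z = v]) auto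
    moreover have "conv J (\<lambda>y. M - q y) u = 0"
      using conv_diff[OF J_cs bounded_borel_const assms(1)] conv_J_const assms(2) that(1) by simp
    ultimately show False by simp
  qed
  have "open {y. q y = M}"
    unfolding open_contains_ball using step r(1) by (auto simp: subset_iff intro!: exI[of _ r])
  moreover have "closed {y. q y = M}" by (intro closed_Collect_eq q_cont continuous_on_const)
  moreover have "z \<in> {y. q y = M}" by (simp add: M_def)
  ultimately have "{y. q y = M} = UNIV"
    using clopen[of "{y. q y = M}"] by blast
  then have all: "q y = M" for y by blast
  obtain y :: "(real, 'n) vec" where "norm y = \<bar>b\<bar>" by (rule vector_choose_size[of "\<bar>b\<bar>"]) auto
  then have "\<bar>q y\<bar> < q x" using abs_ge_self[of b] by (intro b) simp
  then show False using \<open>q x \<le> M\<close> all[of y] abs_ge_self[of "q y"] by linarith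
qed

lemma J_averaged_eq_0:
  assumes "bounded_borel q" "\<And>x. conv J q x = q x" "(q \<longlongrightarrow> 0) at_infinity"
  shows "q x = 0"
proof -
  have "- q x \<le> 0"
    using assms(1,2) tendsto_minus[OF assms(3)] bounded_borel_cmult[OF assms(1), of "-1"]
      conv_cmult[of J "-1" q]
    by (intro J_averaged_le_0[where q = "\<lambda>x. - q x"]) simp_all
  then show ?thesis using J_averaged_le_0[OF assms, of x] by simp
qed

definition Jpow :: "nat \<Rightarrow> (real, 'n) vec \<Rightarrow> real" where
  "Jpow n = (conv J ^^ n) J"

lemma Jpow_simps: "Jpow 0 = J" "Jpow (Suc n) = conv J (Jpow n)"
  by (simp_all add: Jpow_def)

lemma Jpow_cs: "bounded_borel_cs (Jpow n)"
  by (induction n) (auto simp: Jpow_simps J_cs bounded_borel_cs_conv)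

lemma Jpow_cont: "continuous_on UNIV (Jpow n)"
  by (cases n) (auto simp: Jpow_simps J_cont intro!: continuous_conv[OF J_cont J_support] bounded_borel_cs_imp Jpow_cs)

lemma Jpow_nonneg: "0 \<le> Jpow n x"
proof (induction n arbitrary: x)
  case (Suc n)
  then show ?case unfolding Jpow_simps conv_def by (simp add: J_nonneg)
qed (simp add: Jpow_simps J_nonneg)

lemma Jpow_support: "norm x > real n + 1 \<Longrightarrow> Jpow n x = 0"
proof (induction n arbitrary: x)
  case (Suc n)
  show ?case unfolding Jpow_simps
    by (rule conv_support[of 1 J "real n + 1"]) (use Suc J_support in auto)
qed (simp add: Jpow_simps J_support)

text \<open>The point \<open>x\<close> is reached from 0 in \<open>n + 1\<close> equal steps, each shorter than \<open>r\<close>.\<close>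

lemma Jpow_pos:
  assumes "\<And>x. norm x < r \<Longrightarrow> 0 < J x" "norm x < (real n + 1) * r"
  shows "0 < Jpow n x"
  using assms(2)
proof (induction n arbitrary: x)
  case (Suc n)
  define z where "z = ((real n + 1) / (real n + 2)) *\<^sub>R x"
  have "norm x / (real n + 2) < r" using Suc.prems by (simp add: divide_less_eq algebra_simps)
  moreover have "norm z = (real n + 1) * (norm x / (real n + 2))" by (simp add: z_def)
  moreover have "x - z = (1 / (real n + 2)) *\<^sub>R x"
  proof -
    have "1 - (real n + 1) / (real n + 2) = 1 / (real n + 2)" by (simp add: field_simps)
    then show ?thesis unfolding z_def by (metis scaleR_left_diff_distrib scaleR_one)
  qed
  then have "norm (x - z) = norm x / (real n + 2)" by simp
  moreover have "(real n + 1) * (norm x / (real n + 2)) < (real n + 1) * r"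
    using \<open>norm x / (real n + 2) < r\<close> by (intro mult_strict_left_mono) auto
  ultimately have "0 < J (x - z)" "0 < Jpow n z"
    using Suc.IH[of z] assms(1)[of "x - z"] by metis+
  then have "0 < J (x - z) * Jpow n z" by simp
  moreover have "continuous_on UNIV (\<lambda>y. J (x - y) * Jpow n y)"
    by (intro continuous_intros Jpow_cont continuous_on_compose2[OF J_cont]) auto
  moreover have "integrable lborel (\<lambda>y. J (x - y) * Jpow n y)"
    by (rule conv_integrable[OF J_cs bounded_borel_cs_imp[OF Jpow_cs]])
  ultimately show ?case
    unfolding Jpow_simps conv_def using J_nonneg Jpow_nonneg
    by (intro integral_pos_of_continuous[where z = z]) auto
qed (use assms in \<open>simp add: Jpow_simps\<close>)

lemma conv_Jpow_fixed:
  assumes "bounded_borel w" "\<And>x. norm x > R \<Longrightarrow> conv J w x = w x" "norm x > R + real n"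
  shows "conv (Jpow n) w x = w x"
  using assms(3)
proof (induction n arbitrary: x)
  case (Suc n)
  have "conv (Jpow (Suc n)) w x = conv J (conv (Jpow n) w) x"
    unfolding Jpow_simps using conv_assoc[OF J_cs Jpow_cs assms(1)] by simp
  also have "\<dots> = conv J w x"
  proof (rule conv_cong[where r = 1])
    fix y assume "norm (x - y) \<le> 1"
    then show "conv (Jpow n) w y = w y"
      using Suc.prems norm_triangle_sub[of x y] by (intro Suc.IH) auto
  qed (rule J_support)
  also have "\<dots> = w x" using Suc.prems by (intro assms(2)) simp
  finally show ?case .
qed (use assms in \<open>simp add: Jpow_simps\<close>)

lemma Jpow_mass: "(LINT x|lborel. Jpow n x) = 1"
  using conv_Jpow_fixed[where w = "\<lambda>_. 1" and R = "- real n - 1" and x = 0 and n = n] conv_J_const[of 1] conv_const[of "Jpow n" 1 0]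
  by simp

text \<open>For large \<open>n\<close> the power \<open>Jpow n\<close> is positive on the support of \<open>\<kappa>\<close>, so that \<open>k = K Jpow n - \<kappa>\<close> is nonnegative for a
  suitable \<open>K\<close>. Averaging \<open>M - w \<ge> 0\<close> with \<open>k\<close> gives \<open>0 \<le> K (M - w x) - a M\<close>, where \<open>a\<close> is the mass of \<open>\<kappa>\<close>.\<close>

lemma contraction:
  assumes \<kappa>: "continuous_on UNIV \<kappa>" "\<And>x. norm x > s \<Longrightarrow> \<kappa> x = 0" "0 < (LINT x|lborel. \<kappa> x)"
  shows "\<exists>\<theta> m. 0 < \<theta> \<and> \<theta> < 1 \<and> 0 < m \<and> (\<forall>w R M x. bounded_borel w \<longrightarrow>
     (\<forall>y. norm y > R \<longrightarrow> conv J w y = w y \<and> conv \<kappa> w y = 0 \<and> w y \<le> M) \<longrightarrow> 0 \<le> M \<longrightarrow>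
     norm x > R + m \<longrightarrow> w x \<le> \<theta> * M)"
proof -
  define a where "a = (LINT x|lborel. \<kappa> x)"
  have \<kappa>cs: "bounded_borel_cs \<kappa>" by (rule continuous_cs_bounded_borel_cs[OF \<kappa>(1,2)])
  obtain L where L: "\<And>x. \<bar>\<kappa> x\<bar> \<le> L" "L > 0" using bounded_borel_bound[OF bounded_borel_cs_imp[OF \<kappa>cs]] by metis
  obtain r where r: "0 < r" "\<And>x. norm x < r \<Longrightarrow> 0 < J x" using J_pos_ball by blast
  obtain n :: nat where n: "\<bar>s\<bar> / r < real n" using reals_Archimedean2 by blast
  have sn: "\<bar>s\<bar> < (real n + 1) * r"
  proof -
    have "\<bar>s\<bar> < real n * r" using n r(1) by (simp add: divide_less_eq)
    then show ?thesis using r(1) by (simp add: distrib_right)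
  qed
  obtain z where z: "z \<in> cball 0 \<bar>s\<bar>" "\<And>y. y \<in> cball 0 \<bar>s\<bar> \<Longrightarrow> Jpow n z \<le> Jpow n y"
    using continuous_attains_inf[of "cball 0 \<bar>s\<bar>" "Jpow n"] continuous_on_subset[OF Jpow_cont]
    by (metis abs_ge_zero cball_eq_empty compact_cball not_le subset_UNIV)
  define c where "c = Jpow n z"
  have "c > 0" unfolding c_def using z(1) sn by (intro Jpow_pos[OF r(2)]) auto
  \<comment> \<open>The first summand makes \<open>K Jpow n\<close> dominate \<open>\<kappa>\<close>, the other two give \<open>K > a\<close>, so that \<open>1 - a / K\<close> is positive.\<close>
  define K where "K = L / c + a + 1"
  have "K > 0" "K > a" "a > 0"
    unfolding K_def using \<open>c > 0\<close> L(2) \<kappa>(3) by (auto simp: a_def add_pos_pos)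
  have K: "\<kappa> y \<le> K * Jpow n y" for y
  proof (cases "norm y > s")
    case True
    then show ?thesis using \<kappa>(2) Jpow_nonneg \<open>K > 0\<close> by simp
  next
    case False
    then have "c \<le> Jpow n y" unfolding c_def by (intro z(2)) auto
    have "\<kappa> y \<le> L / c * c" using L(1)[of y] \<open>c > 0\<close> by simp
    also have "\<dots> \<le> K * c" using \<open>a > 0\<close> \<open>c > 0\<close> unfolding K_def by (intro mult_right_mono) auto
    also have "\<dots> \<le> K * Jpow n y" using \<open>c \<le> Jpow n y\<close> \<open>K > 0\<close> by simp
    finally show ?thesis .
  qed
  define m where "m = max \<bar>s\<bar> (real n + 1)"
  define k where "k y = K * Jpow n y - \<kappa> y" for y
  have kcs: "bounded_borel_cs k"
    unfolding k_def by (intro bounded_borel_cs_diff bounded_borel_cs_cmult Jpow_cs \<kappa>cs)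
  have k0: "k y = 0" if "norm y > m" for y
    using that \<kappa>(2)[of y] Jpow_support[of n y] unfolding k_def m_def by auto
  show ?thesis
  proof (rule exI[of _ "1 - a / K"], rule exI[of _ m], intro conjI allI impI)
    show "0 < 1 - a / K" "1 - a / K < 1" using \<open>K > a\<close> \<open>a > 0\<close> \<open>K > 0\<close> by auto
    show "0 < m" unfolding m_def by auto
    fix w :: "(real, 'n) vec \<Rightarrow> real" and R M :: real and x :: "(real, 'n) vec"
    assume w: "bounded_borel w" and "0 \<le> M" and x: "norm x > R + m"
      and far: "\<forall>y. norm y > R \<longrightarrow> conv J w y = w y \<and> conv \<kappa> w y = 0 \<and> w y \<le> M"
    have fixp: "conv J w y = w y" and zero: "conv \<kappa> w y = 0" and wM: "w y \<le> M" if "norm y > R" for y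
      using far that by auto
    have "conv k w x \<le> conv k (\<lambda>_. M) x"
    proof (rule conv_mono[OF kcs w bounded_borel_const _ _ k0])
      show "0 \<le> k y" for y using K[of y] unfolding k_def by simp
      fix y assume "norm (x - y) \<le> m"
      then show "w y \<le> M" using x norm_triangle_sub[of x y] by (intro wM) auto
    qed
    moreover have lin: "conv k g x = K * conv (Jpow n) g x - conv \<kappa> g x" if "bounded_borel g" for g
    proof -
      have "conv k g x = (LINT y|lborel. K * (Jpow n (x - y) * g y) - \<kappa> (x - y) * g y)"
        unfolding conv_def k_def by (simp add: left_diff_distrib mult.assoc)
      also have "\<dots> = K * conv (Jpow n) g x - conv \<kappa> g x"
        unfolding conv_def using conv_integrable[OF Jpow_cs that] conv_integrable[OF \<kappa>cs that]
        by (subst Bochner_Integration.integral_diff) auto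
      finally show ?thesis .
    qed
    moreover have "conv (Jpow n) w x = w x"
      using x by (intro conv_Jpow_fixed[OF w fixp]) (auto simp: m_def)
    moreover have "conv \<kappa> w x = 0" using x \<open>0 < m\<close> by (intro zero) simp
    ultimately have "K * w x \<le> K * M - M * a"
      using lin[OF w] lin[OF bounded_borel_const, of M] by (simp add: conv_const Jpow_mass a_def)
    then show "w x \<le> (1 - a / K) * M"
      using \<open>K > 0\<close> by (simp add: field_simps)
  qed
qed

text \<open>Each step outwards by \<open>m\<close> multiplies the bound for \<open>w\<close> and for \<open>- w\<close> by \<open>\<theta>\<close>.\<close>

lemma exponential_decay:
  assumes \<kappa>: "continuous_on UNIV \<kappa>" "\<And>x. norm x > s \<Longrightarrow> \<kappa> x = 0" "0 < (LINT x|lborel. \<kappa> x)"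
    and w: "bounded_borel w" and fixp: "\<And>x. norm x > R \<Longrightarrow> conv J w x = w x"
    and zero: "\<And>x. norm x > R \<Longrightarrow> conv \<kappa> w x = 0"
  obtains A c where "0 < A" "0 < c" "\<And>x. \<bar>w x\<bar> \<le> A * exp (- c * norm x)"
proof -
  obtain \<theta> m where \<theta>: "0 < \<theta>" "\<theta> < 1" "0 < m"
    and con: "\<And>w R M x. \<lbrakk>bounded_borel w; \<forall>y. norm y > R \<longrightarrow> conv J w y = w y \<and> conv \<kappa> w y = 0 \<and> w y \<le> M;
       0 \<le> M; norm x > R + m\<rbrakk> \<Longrightarrow> w x \<le> \<theta> * M"
    using contraction[OF \<kappa>] by blast
  obtain M where M: "0 < M" "\<And>x. \<bar>w x\<bar> \<le> M" using bounded_borel_bound[OF w] by metis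
  have w': "bounded_borel (\<lambda>x. - w x)" using bounded_borel_cmult[OF w, of "-1"] by simp
  have geo: "\<bar>w x\<bar> \<le> \<theta> ^ n * M" if "norm x > R + real n * m" for n x
    using that
  proof (induction n arbitrary: x)
    case (Suc n)
    have far: "norm y > R" if "norm y > R + real n * m" for y
      using that \<open>0 < m\<close> by (smt (verit) mult_nonneg_nonneg of_nat_0_le_iff)
    have nx: "norm x > R + real n * m + m" using Suc.prems by (simp add: algebra_simps)
    have "w x \<le> \<theta> * (\<theta> ^ n * M)"
      by (rule con[OF w _ _ nx]) (use far fixp zero Suc.IH \<theta> M in \<open>auto simp: abs_le_iff\<close>)
    moreover have "- w x \<le> \<theta> * (\<theta> ^ n * M)"
      by (rule con[OF w' _ _ nx])
        (use far fixp zero Suc.IH \<theta> M conv_cmult[of J "-1" w] conv_cmult[of \<kappa> "-1" w] in \<open>auto simp: abs_le_iff\<close>)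
    ultimately show ?case by (simp add: abs_le_iff)
  qed (use M in simp)
  define c where "c = - ln \<theta> / m"
  have "c > 0" unfolding c_def using \<theta> by (simp add: field_simps)
  have th: "\<theta> = exp (- c * m)" unfolding c_def using \<theta> by simp
  define A where "A = M * exp (c * (\<bar>R\<bar> + m))"
  have A: "M * exp (c * (\<bar>R\<bar> + m) + - c * norm x) = A * exp (- c * norm x)" for x :: "(real, 'n) vec"
    unfolding A_def exp_add mult.assoc ..
  have "\<bar>w x\<bar> \<le> A * exp (- c * norm x)" for x
  proof (cases "norm x > \<bar>R\<bar>")
    case True
    define n where "n = nat (\<lceil>(norm x - \<bar>R\<bar>) / m\<rceil> - 1)"
    have pos: "(norm x - \<bar>R\<bar>) / m > 0" using True \<open>0 < m\<close> by simp
    then have rn: "real n = of_int \<lceil>(norm x - \<bar>R\<bar>) / m\<rceil> - 1" unfolding n_def by simp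
    then have "real n < (norm x - \<bar>R\<bar>) / m" "(norm x - \<bar>R\<bar>) / m \<le> real n + 1"
      using ceiling_correct[of "(norm x - \<bar>R\<bar>) / m"] by linarith+
    then have n: "real n * m < norm x - \<bar>R\<bar>" "norm x - \<bar>R\<bar> \<le> (real n + 1) * m"
      using \<open>0 < m\<close> by (simp_all add: less_divide_eq divide_le_eq)
    have "\<bar>w x\<bar> \<le> \<theta> ^ n * M" using n(1) by (intro geo) linarith
    also have "\<theta> ^ n = exp (- c * (real n * m))"
      unfolding th by (simp add: exp_of_nat_mult[symmetric] algebra_simps)
    also have "exp (- c * (real n * m)) \<le> exp (c * (\<bar>R\<bar> + m) + - c * norm x)"
    proof -
      have "c * (norm x - \<bar>R\<bar>) \<le> c * ((real n + 1) * m)" using n(2) \<open>c > 0\<close> by simp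
      then show ?thesis by (simp add: algebra_simps)
    qed
    finally show ?thesis using M(1) unfolding A[symmetric] by (simp add: mult.commute)
  next
    case False
    have "\<bar>w x\<bar> \<le> M * 1" using M(2) by simp
    also have "\<dots> \<le> M * exp (c * (\<bar>R\<bar> + m) + - c * norm x)"
    proof -
      have "0 \<le> c * (\<bar>R\<bar> + m - norm x)" using False \<open>c > 0\<close> \<open>0 < m\<close> by simp
      then show ?thesis using M(1) by (intro mult_left_mono) (auto simp: algebra_simps)
    qed
    finally show ?thesis unfolding A .
  qed
  moreover have "A > 0" unfolding A_def using M by simp
  ultimately show thesis using that \<open>c > 0\<close> by blast
qed

end

section \<open>Approximation by a Newtonian potential\<close>

definition newton :: "real^'n::finite \<Rightarrow> real" where
  "newton y = norm y powr (2 - real CARD('n))"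

text \<open>Cap 1 gives the bounded substitute \<open>P\<close> for \<open>newton\<close>; other caps serve to compare \<open>P\<close> with \<open>newton\<close> near a point outside the unit ball,
  since \<open>newton\<close> itself is unbounded.\<close>

definition capped_newton :: "real \<Rightarrow> real^'n::finite \<Rightarrow> real" where
  "capped_newton \<delta> y = max (norm y) \<delta> powr (2 - real CARD('n))"

lemma capped_newton_eq: "norm y \<ge> \<delta> \<Longrightarrow> capped_newton \<delta> y = newton y"
  by (simp add: capped_newton_def newton_def max_def)

context jump_kernel
begin

lemma capped_newton_bounds:
  fixes y :: "(real, 'n) vec"
  assumes "\<delta> > 0" shows "0 \<le> capped_newton \<delta> y" "capped_newton \<delta> y \<le> \<delta> powr (2 - real CARD('n))"
  unfolding capped_newton_def using dim assms by (auto intro!: powr_mono2')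

lemma capped_newton_cont:
  assumes "\<delta> > 0" shows "continuous_on UNIV (capped_newton \<delta> :: (real, 'n) vec \<Rightarrow> real)"
  unfolding capped_newton_def using assms by (intro continuous_intros) auto

lemma capped_newton_bounded_borel:
  assumes "\<delta> > 0" shows "bounded_borel (capped_newton \<delta> :: (real, 'n) vec \<Rightarrow> real)"
  unfolding bounded_borel_def
  using borel_measurable_continuous_onI[OF capped_newton_cont[OF assms]] capped_newton_bounds[OF assms]
  by (metis abs_of_nonneg)

lemma capped_newton_tendsto_0:
  "((capped_newton \<delta> :: (real, 'n) vec \<Rightarrow> real) \<longlongrightarrow> 0) at_infinity"
proof (rule tendsto_cong[THEN iffD1])
  show "\<forall>\<^sub>F y in at_infinity. newton y = (capped_newton \<delta> y :: real)"
    unfolding eventually_at_infinity using capped_newton_eq by metis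
  show "((newton :: (real, 'n) vec \<Rightarrow> real) \<longlongrightarrow> 0) at_infinity"
    unfolding newton_def
    by (intro tendsto_neg_powr filterlim_norm_at_top) (use dim in auto)
qed

abbreviation P :: "(real, 'n) vec \<Rightarrow> real" where "P \<equiv> capped_newton 1"

lemma P_le_1: "P y \<le> 1"
  using capped_newton_bounds(2)[of 1 y] by simp

definition defect :: "(real, 'n) vec \<Rightarrow> real" where
  "defect x = P x - conv J P x"

lemma conv_J_newton: "norm x > 1 \<Longrightarrow> conv J newton x = newton x"
  using mean_value_newton_kernel[OF _ J_cont J_radial J_support, where x = x] dim J_mass
  unfolding newton_def[abs_def] by simp

lemma defect_cont: "continuous_on UNIV defect"
  unfolding defect_def
  by (intro continuous_on_diff capped_newton_cont continuous_conv[OF J_cont J_support] capped_newton_bounded_borel) auto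

lemma defect_support:
  assumes "norm x > 2" shows "defect x = 0"
proof -
  have "conv J P x = conv J newton x"
  proof (rule conv_cong[where r = 1])
    fix y assume "norm (x - y) \<le> 1"
    then show "P y = newton y"
      using assms norm_triangle_sub[of x y] by (intro capped_newton_eq) simp
  qed (rule J_support)
  then show ?thesis unfolding defect_def using assms by (simp add: conv_J_newton capped_newton_eq)
qed

lemma defect_cs: "bounded_borel_cs defect"
  by (rule continuous_cs_bounded_borel_cs[OF defect_cont defect_support])

text \<open>\<open>P\<close> is superharmonic for \<open>J\<close>, being off 0 the minimum of the constant 1 and of \<open>newton\<close>: in the unit ball compare with the
  constant, outside compare with \<open>newton\<close>.\<close>

lemma defect_nonneg: "0 \<le> defect x"
proof (cases "norm x \<le> 1")
  case True
  have "conv J P x \<le> conv J (\<lambda>_. 1) x"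
    by (rule conv_mono[OF J_cs capped_newton_bounded_borel bounded_borel_const J_nonneg _ J_support])
       (auto simp: P_le_1)
  also have "\<dots> = P x" using True by (simp add: conv_J_const capped_newton_def max_def)
  finally show ?thesis by (simp add: defect_def)
next
  case False
  define \<delta> where "\<delta> = norm x - 1"
  have "\<delta> > 0" using False by (simp add: \<delta>_def)
  have near: "\<delta> \<le> norm y" if "norm (x - y) \<le> 1" for y
    using that norm_triangle_sub[of x y] by (simp add: \<delta>_def)
  have "conv J P x \<le> conv J (capped_newton \<delta>) x"
  proof (rule conv_mono[OF J_cs _ _ J_nonneg _ J_support])
    fix y assume "norm (x - y) \<le> 1"
    then have "\<delta> \<le> norm y" "0 < norm y" using near[of y] \<open>\<delta> > 0\<close> by auto
    then show "P y \<le> capped_newton \<delta> y"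
      unfolding capped_newton_def using dim by (intro powr_mono2') auto
  qed (auto intro!: capped_newton_bounded_borel \<open>\<delta> > 0\<close>)
  also have "\<dots> = conv J newton x"
    by (rule conv_cong[where r = 1]) (auto intro!: capped_newton_eq near J_support)
  also have "\<dots> = P x" using False by (simp add: conv_J_newton capped_newton_eq)
  finally show ?thesis by (simp add: defect_def)
qed

text \<open>On the unit sphere \<open>P = 1\<close>, while a jump outwards reaches points with \<open>P < 1\<close>.\<close>

lemma defect_mass_pos: "0 < (LINT x|lborel. defect x)"
proof -
  obtain x :: "(real, 'n) vec" where x: "norm x = 1" by (rule vector_choose_size[of 1]) auto
  obtain r where r: "0 < r" "\<And>x. norm x < r \<Longrightarrow> 0 < J x" using J_pos_ball by blast
  define z where "z = (1 + r / 2) *\<^sub>R x"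
  have "x - z = - ((r / 2) *\<^sub>R x)" unfolding z_def by (simp add: scaleR_add_left)
  then have "norm (x - z) = r / 2" using x r(1) by simp
  then have Jz: "0 < J (x - z)" using r by (intro r(2)) simp
  have "norm z = 1 + r / 2" unfolding z_def using x r(1) by simp
  then have "P z < 1"
    unfolding capped_newton_def using r(1) dim by (simp add: powr_less_one)
  then have "0 < J (x - z) * (1 - P z)" using Jz by simp
  moreover have "continuous_on UNIV (\<lambda>y. J (x - y) * (1 - P y))"
    by (intro continuous_intros capped_newton_cont continuous_on_compose2[OF J_cont]) auto
  moreover have "integrable lborel (\<lambda>y. J (x - y) * (1 - P y))"
    by (intro conv_integrable J_cs bounded_borel_diff bounded_borel_const capped_newton_bounded_borel) simp
  ultimately have "0 < conv J (\<lambda>y. 1 - P y) x"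
    unfolding conv_def using J_nonneg P_le_1 by (intro integral_pos_of_continuous[where z = z]) auto
  also have "\<dots> = 1 - conv J P x"
    using conv_diff[OF J_cs bounded_borel_const capped_newton_bounded_borel[of 1]] conv_J_const by simp
  also have "\<dots> = defect x" using x by (simp add: defect_def capped_newton_def)
  finally show ?thesis
    by (intro integral_pos_of_continuous[where z = x] bounded_borel_cs_integrable defect_cs defect_nonneg defect_cont)
qed

lemma conv_defect_P:
  assumes "norm x > 3" shows "conv defect P x = (LINT y|lborel. defect y) * P x"
proof -
  have rad: "defect x = defect y" if "norm x = norm y" for x y
  proof -
    have "conv J P x = conv J P y"
      by (rule conv_radial[OF J_radial _ J_measurable bounded_borel_measurable that])
        (auto simp: capped_newton_def[abs_def] intro!: capped_newton_bounded_borel[unfolded capped_newton_def[abs_def]])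
    then show ?thesis unfolding defect_def capped_newton_def that by simp
  qed
  have "conv defect P x = conv defect newton x"
  proof (rule conv_cong[where r = 2])
    fix y assume "norm (x - y) \<le> 2"
    then show "P y = newton y"
      using assms norm_triangle_sub[of x y] by (intro capped_newton_eq) simp
  qed (rule defect_support)
  also have "\<dots> = (LINT y|lborel. defect y) * newton x"
    using mean_value_newton_kernel[OF _ defect_cont rad defect_support, where x = x] dim assms
    unfolding newton_def[abs_def] by simp
  finally show ?thesis using assms by (simp add: capped_newton_eq)
qed

text \<open>The remainder \<open>w = \<psi> - v\<close> satisfies the two relations that \<open>exponential_decay\<close> needs, with \<open>\<kappa> = defect\<close>: \<open>h = w - J * w\<close> has bounded
  support by construction, and \<open>defect * w\<close> equals \<open>f * Q\<close> with \<open>Q = P - (defect * P) / a\<close>, because both have the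
  same image \<open>defect * h\<close> under \<open>\<delta> - J\<close> and tend to 0, so that their difference vanishes by the maximum principle. The function \<open>Q\<close> has bounded support by the mean value property.\<close>

lemma potential_approximation:
  assumes \<psi>: "bounded_borel \<psi>" "(\<psi> \<longlongrightarrow> 0) at_infinity" "bounded_borel_cs (\<lambda>x. \<psi> x - conv J \<psi> x)"
  defines "f \<equiv> \<lambda>x. \<psi> x - conv J \<psi> x" and "a \<equiv> LINT x|lborel. defect x"
  shows "\<exists>w A c R. (\<forall>x. \<psi> x = conv f P x / a + w x) \<and> bounded_borel w \<and> 0 < A \<and> 0 < c \<and>
    (\<forall>x. \<bar>w x\<bar> \<le> A * exp (- c * norm x)) \<and> (\<forall>x. norm x > R \<longrightarrow> conv J w x = w x)"
proof -
  have f: "bounded_borel_cs f" using \<psi>(3) by (simp add: f_def)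
  have a: "a > 0" unfolding a_def by (rule defect_mass_pos)
  have P: "bounded_borel P" by (rule capped_newton_bounded_borel) simp
  note defect = defect_cs bounded_borel_cs_imp[OF defect_cs]
  define b where "b = 1 / a"
  define v where "v x = b * conv f P x" for x
  define w where "w x = \<psi> x - v x" for x
  have fP: "bounded_borel (conv f P)" by (rule bounded_borel_conv[OF f P])
  have v: "bounded_borel v" unfolding v_def[abs_def] by (rule bounded_borel_cmult[OF fP])
  have w: "bounded_borel w" unfolding w_def[abs_def] by (rule bounded_borel_diff[OF \<psi>(1) v])
  have "(v \<longlongrightarrow> 0) at_infinity"
    unfolding v_def[abs_def] using tendsto_mult_right_zero[OF conv_tendsto_0[OF f P capped_newton_tendsto_0]] .
  then have w_lim: "(w \<longlongrightarrow> 0) at_infinity"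
    unfolding w_def[abs_def] using tendsto_diff[OF \<psi>(2)] by fastforce
  have commute_JP: "conv J (conv g P) x = conv g P x - conv g defect x" if g: "bounded_borel_cs g" for g x
  proof -
    have "conv J (conv g P) = conv g (conv J P)" by (rule conv_left_commute[OF J_cs g P])
    moreover have "conv J P = (\<lambda>x. P x - defect x)" by (simp add: defect_def)
    ultimately show ?thesis using conv_diff[OF g P defect(2)] by simp
  qed
  have Jv: "conv J v x = v x - b * conv f defect x" for x
    unfolding v_def[abs_def] conv_cmult commute_JP[OF f] by (simp add: right_diff_distrib)
  define h where "h x = f x - b * conv f defect x" for x
  have h: "bounded_borel_cs h" unfolding h_def[abs_def]
    by (intro bounded_borel_cs_diff bounded_borel_cs_cmult bounded_borel_cs_conv f defect)
  have Jw: "conv J w x = w x - h x" for x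
  proof -
    have "conv J w x = conv J \<psi> x - conv J v x" unfolding w_def[abs_def] by (rule conv_diff[OF J_cs \<psi>(1) v])
    also have "\<dots> = w x - h x" unfolding Jv w_def h_def f_def by simp
    finally show ?thesis .
  qed
  define Q where "Q x = P x - b * conv defect P x" for x
  have Q: "bounded_borel_cs Q"
  proof -
    have "bounded_borel Q" unfolding Q_def[abs_def]
      by (intro bounded_borel_diff bounded_borel_cmult bounded_borel_conv defect P)
    moreover have "Q x = 0" if "norm x > 3" for x
      using conv_defect_P[OF that] a unfolding Q_def b_def a_def by simp
    ultimately show ?thesis unfolding bounded_borel_cs_def by blast
  qed
  define q where "q x = conv defect w x - conv f Q x" for x
  have dw: "bounded_borel (conv defect w)" and fQ: "bounded_borel_cs (conv f Q)"
    by (rule bounded_borel_conv[OF defect(1) w] bounded_borel_cs_conv[OF f Q])+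
  have "q x = 0" for x
  proof (rule J_averaged_eq_0)
    show "bounded_borel q" unfolding q_def[abs_def]
      by (rule bounded_borel_diff[OF dw bounded_borel_cs_imp[OF fQ]])
    show "(q \<longlongrightarrow> 0) at_infinity" unfolding q_def[abs_def]
      using tendsto_diff[OF conv_tendsto_0[OF defect(1) w w_lim] tendsto_0_cs[OF fQ]] by simp
    fix x
    have dP: "bounded_borel (conv defect P)" by (rule bounded_borel_conv[OF defect(1) P])
    have dd: "bounded_borel (conv defect defect)" by (rule bounded_borel_conv[OF defect])
    have JQ: "conv J Q x = Q x - (defect x - b * conv defect defect x)" for x
    proof -
      have "conv J Q x = conv J P x - b * conv J (conv defect P) x"
        unfolding Q_def[abs_def] by (rule conv_diff_cmult[OF J_cs P dP])
      then show ?thesis unfolding commute_JP[OF defect(1)] Q_def defect_def[of x] by (simp add: algebra_simps)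
    qed
    have "conv J (conv defect w) x = conv defect (conv J w) x"
      by (simp add: conv_left_commute[OF J_cs defect(1) w])
    also have "\<dots> = conv defect w x - conv defect h x"
      unfolding Jw[abs_def] by (rule conv_diff[OF defect(1) w bounded_borel_cs_imp[OF h]])
    finally have 1: "conv J (conv defect w) x = conv defect w x - conv defect h x" .
    have "conv J (conv f Q) x = conv f (conv J Q) x"
      by (simp add: conv_left_commute[OF J_cs f bounded_borel_cs_imp[OF Q]])
    also have "\<dots> = conv f Q x - conv f (\<lambda>x. defect x - b * conv defect defect x) x"
      unfolding JQ[abs_def]
      by (intro conv_diff f bounded_borel_cs_imp[OF Q] bounded_borel_diff bounded_borel_cmult defect dd)
    also have "conv f (\<lambda>x. defect x - b * conv defect defect x) x
        = conv f defect x - b * conv f (conv defect defect) x"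
      by (rule conv_diff_cmult[OF f defect(2) dd])
    also have "conv f (conv defect defect) = conv defect (conv f defect)"
      by (rule conv_left_commute[OF f defect])
    finally have 2: "conv J (conv f Q) x = conv f Q x - (conv f defect x - b * conv defect (conv f defect) x)" .
    have 3: "conv defect h x = conv defect f x - b * conv defect (conv f defect) x"
      unfolding h_def[abs_def]
      by (rule conv_diff_cmult[OF defect(1) bounded_borel_cs_imp[OF f] bounded_borel_conv[OF f defect(2)]])
    have "conv J q x = conv J (conv defect w) x - conv J (conv f Q) x"
      unfolding q_def[abs_def] by (rule conv_diff[OF J_cs dw bounded_borel_cs_imp[OF fQ]])
    then show "conv J q x = q x" unfolding 1 2 3 q_def by (simp add: conv_commute[of defect f])
  qed
  then have dw_eq: "conv defect w x = conv f Q x" for x by (simp add: q_def)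
  obtain R1 where R1: "\<And>x. norm x > R1 \<Longrightarrow> h x = 0" using bounded_borel_cs_support[OF h] by metis
  obtain R2 where R2: "\<And>x. norm x > R2 \<Longrightarrow> conv f Q x = 0" using bounded_borel_cs_support[OF fQ] by metis
  obtain A c where "0 < A" "0 < c" "\<And>x. \<bar>w x\<bar> \<le> A * exp (- c * norm x)"
  proof (rule exponential_decay[OF defect_cont defect_support defect_mass_pos w])
    show "conv J w x = w x" if "norm x > max R1 R2" for x using Jw[of x] R1[of x] that by simp
    show "conv defect w x = 0" if "norm x > max R1 R2" for x using dw_eq[of x] R2[of x] that by simp
  qed blast+
  moreover have "\<psi> x = conv f P x / a + w x" for x by (simp add: w_def v_def b_def)
  moreover have "conv J w x = w x" if "norm x > R1" for x using Jw[of x] R1[OF that] by simp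
  ultimately show ?thesis using w by blast
qed

end

section \<open>Iterated partial derivatives and homogeneous functions\<close>

text \<open>A list of coordinates replaces the multi-index, so that one can argue by induction on the number of derivatives.\<close>

definition pd :: "'n list \<Rightarrow> (real^'n \<Rightarrow> real) \<Rightarrow> real^'n \<Rightarrow> real" where
  "pd L f = foldr partial_deriv L f"

lemma pd_Nil [simp]: "pd [] f = f" and pd_Cons: "pd (i # L) f = partial_deriv i (pd L f)"
  by (simp_all add: pd_def)

lemma multi_deriv_eq_pd:
  fixes \<beta> :: "nat^'n::{finite,wellorder}"
  obtains L :: "'n list" where "length L = multi_order \<beta>" "\<And>f. multi_deriv \<beta> f = pd L f"
proof
  let ?xs = "sorted_list_of_set (UNIV :: 'n set)"
  let ?L = "concat (map (\<lambda>i. replicate (\<beta> $ i) i) ?xs)"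
  have "length ?L = (\<Sum>i\<leftarrow>?xs. \<beta> $ i)" by (simp add: length_concat comp_def)
  also have "\<dots> = multi_order \<beta>"
    unfolding multi_order_def by (subst sum_list_distinct_conv_sum_set) auto
  finally show "length ?L = multi_order \<beta>" .
  have rep: "foldr g (replicate n i) f = (g i ^^ n) f" for g :: "'n \<Rightarrow> ((real, 'n) vec \<Rightarrow> real) \<Rightarrow> (real, 'n) vec \<Rightarrow> real" and n i f
    by (induction n) auto
  have "foldr (\<lambda>i. partial_deriv i ^^ (\<beta> $ i)) xs f
      = foldr partial_deriv (concat (map (\<lambda>i. replicate (\<beta> $ i) i) xs)) f" for xs :: "'n list" and f
    by (induction xs) (simp_all add: rep)
  then show "multi_deriv \<beta> f = pd ?L f" for f by (simp add: multi_deriv_def pd_def)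
qed

text \<open>The value of \<open>partial_deriv\<close> is arbitrary where no derivative exists; here all iterated partial derivatives exist
  at the points of \<open>U\<close>.\<close>

definition partially_smooth :: "(real^'n) set \<Rightarrow> (real^'n \<Rightarrow> real) \<Rightarrow> bool" where
  "partially_smooth U f \<longleftrightarrow> (\<forall>L i. \<forall>x\<in>U.
     ((\<lambda>t. pd L f (x + t *\<^sub>R axis i 1)) has_real_derivative pd (i # L) f x) (at 0))"

lemma partially_smoothD:
  "partially_smooth U f \<Longrightarrow> x \<in> U \<Longrightarrow>
     ((\<lambda>t. pd L f (x + t *\<^sub>R axis i 1)) has_real_derivative pd (i # L) f x) (at 0)"
  by (simp add: partially_smooth_def)

lemma DERIV_line_cong:
  fixes f g :: "'a::real_normed_vector \<Rightarrow> real"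
  assumes "((\<lambda>t. f (x + t *\<^sub>R e)) has_real_derivative D) (at 0)" "open V" "x \<in> V" "\<And>y. y \<in> V \<Longrightarrow> f y = g y"
  shows "((\<lambda>t. g (x + t *\<^sub>R e)) has_real_derivative D) (at 0)"
proof (rule has_field_derivative_transform_within_open[OF assms(1)])
  show "open ((\<lambda>t. x + t *\<^sub>R e) -` V)"
    by (intro open_vimage assms(2) continuous_intros)
qed (use assms in auto)

text \<open>A family indexed by lists that is closed under partial differentiation consists of the iterated partial derivatives of
  its first member. Openness of \<open>V\<close> matters, since a derivative at a point depends on the values nearby.\<close>

lemma pd_family:
  fixes f :: "real^'n \<Rightarrow> real"
  assumes "open V" "\<And>x. x \<in> V \<Longrightarrow> F [] x = f x"
    and F: "\<And>L i x. x \<in> V \<Longrightarrow> ((\<lambda>t. F L (x + t *\<^sub>R axis i 1)) has_real_derivative F (i # L) x) (at 0)"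
  shows "x \<in> V \<Longrightarrow> pd L f x = F L x" and "partially_smooth V f"
proof -
  have eq: "pd L f x = F L x" if "x \<in> V" for L x
    using that
  proof (induction L arbitrary: x)
    case (Cons i L)
    have "((\<lambda>t. pd L f (x + t *\<^sub>R axis i 1)) has_real_derivative F (i # L) x) (at 0)"
      by (rule DERIV_line_cong[OF F[OF Cons.prems] assms(1) Cons.prems]) (simp add: Cons.IH)
    then show ?case unfolding pd_Cons partial_deriv_def by (rule DERIV_imp_deriv)
  qed (simp add: assms(2))
  then show "x \<in> V \<Longrightarrow> pd L f x = F L x" by blast
  have "((\<lambda>t. pd L f (x + t *\<^sub>R axis i 1)) has_real_derivative pd (i # L) f x) (at 0)" if "x \<in> V" for x i L
    unfolding eq[OF that] by (rule DERIV_line_cong[OF F[OF that] assms(1) that]) (simp add: eq)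
  then show "partially_smooth V f" unfolding partially_smooth_def by blast
qed

lemma pd_cong:
  assumes "open V" "\<And>x. x \<in> V \<Longrightarrow> f x = g x" "partially_smooth V f"
  shows "x \<in> V \<Longrightarrow> pd L g x = pd L f x" and "partially_smooth V g"
  using pd_family[of V "\<lambda>L. pd L f" g, OF assms(1) _ partially_smoothD[OF assms(3)]] assms(2) by auto

lemma smooth_on_UNIV_pd:
  assumes "smooth_on UNIV f"
  shows "partially_smooth UNIV f" and "continuous_on UNIV (pd L f)"
proof -
  have sm: "smooth_on UNIV (pd L f)" for L
  proof (induction L)
    case (Cons i L)
    then have "Ck_on (Suc k) UNIV (pd L f)" for k unfolding smooth_on_def by blast
    then show ?case unfolding smooth_on_def pd_Cons by simp
  qed (simp add: assms)
  then have "Ck_on 0 UNIV (pd L f)" for L unfolding smooth_on_def by blast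
  then show "continuous_on UNIV (pd L f)" by simp
  have "((\<lambda>t. pd L f (x + t *\<^sub>R axis i 1)) has_real_derivative pd (i # L) f x) (at 0)" for L i x
  proof -
    have "Ck_on (Suc 0) UNIV (pd L f)" using sm unfolding smooth_on_def by blast
    then have "pd L f differentiable (at (x + 0 *\<^sub>R axis i 1))" by simp
    then have "((pd L f) \<circ> (\<lambda>t::real. x + t *\<^sub>R axis i 1)) differentiable (at 0)"
      by (intro differentiable_chain_at) (auto intro!: derivative_intros)
    then have "(\<lambda>t. pd L f (x + t *\<^sub>R axis i 1)) field_differentiable (at 0)"
      unfolding comp_def by (simp add: field_differentiable_def real_differentiable_def[symmetric])
    then show ?thesis unfolding pd_Cons partial_deriv_def
      by (simp add: DERIV_deriv_iff_field_differentiable)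
  qed
  then show "partially_smooth UNIV f" unfolding partially_smooth_def by blast
qed

lemma pd_conv:
  fixes k h :: "real^'n::finite \<Rightarrow> real"
  assumes U: "open U" and k: "partially_smooth U k" "\<And>L. continuous_on U (pd L k)"
    and S: "compact S" "bounded_borel h" "\<And>y. y \<notin> S \<Longrightarrow> h y = 0"
    and V: "open V" "\<And>x y. x \<in> V \<Longrightarrow> y \<in> S \<Longrightarrow> x - y \<in> U"
  shows "x \<in> V \<Longrightarrow> pd L (conv k h) x = conv (pd L k) h x" and "partially_smooth V (conv k h)"
proof -
  have "((\<lambda>t. conv (pd L k) h (x + t *\<^sub>R axis i 1)) has_real_derivative conv (pd (i # L) k) h x) (at 0)"
    if "x \<in> V" for L i x
    by (rule conv_has_pderiv[OF U k(2) k(2) partially_smoothD[OF k(1)] _ S V(2)[OF that]]) auto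
  from pd_family[of V "\<lambda>L. conv (pd L k) h", OF V(1) _ this]
  show "x \<in> V \<Longrightarrow> pd L (conv k h) x = conv (pd L k) h x" "partially_smooth V (conv k h)" by auto
qed

text \<open>Not all homogeneous functions, but a class of them that contains \<open>newton\<close>, is closed under partial derivatives and
  consists of functions that are continuous off 0.\<close>

inductive homogeneous :: "real \<Rightarrow> (real^'n::finite \<Rightarrow> real) \<Rightarrow> bool" where
  norm_powr: "homogeneous p (\<lambda>x. norm x powr p)"
| coord: "homogeneous 1 (\<lambda>x. x $ i)"
| cmult: "homogeneous d f \<Longrightarrow> homogeneous d (\<lambda>x. c * f x)"
| add: "homogeneous d f \<Longrightarrow> homogeneous d g \<Longrightarrow> homogeneous d (\<lambda>x. f x + g x)"
| mult: "homogeneous d f \<Longrightarrow> homogeneous e g \<Longrightarrow> homogeneous (d + e) (\<lambda>x. f x * g x)"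

lemma homogeneous_measurable: "homogeneous d f \<Longrightarrow> f \<in> borel_measurable borel"
  by (induction rule: homogeneous.induct) (auto intro!: borel_measurable_continuous_onI continuous_intros)

lemma homogeneous_continuous: "homogeneous d f \<Longrightarrow> continuous_on (- {0}) f"
  by (induction rule: homogeneous.induct) (auto intro!: continuous_intros)

lemma homogeneous_scale: "homogeneous d f \<Longrightarrow> t > 0 \<Longrightarrow> f (t *\<^sub>R x) = t powr d * f x"
  by (induction rule: homogeneous.induct) (auto simp: powr_mult powr_add algebra_simps)

lemma homogeneous_pderiv:
  "homogeneous d f \<Longrightarrow> \<exists>D. homogeneous (d - 1) D \<and>
     (\<forall>x. x \<noteq> 0 \<longrightarrow> ((\<lambda>t. f (x + t *\<^sub>R axis i 1)) has_real_derivative D x) (at 0))"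
proof (induction rule: homogeneous.induct)
  case (norm_powr p)
  have "homogeneous (p - 2 + 1) (\<lambda>x. norm x powr (p - 2) * x $ i)"
    by (intro homogeneous.intros)
  from homogeneous.cmult[OF this, of p] have "homogeneous (p - 1) (\<lambda>x. p * (norm x powr (p - 2) * x $ i))" by simp
  moreover have "((\<lambda>t. norm (x + t *\<^sub>R axis i 1) powr p) has_real_derivative p * (norm x powr (p - 2) * x $ i)) (at 0)"
    if "x \<noteq> 0" for x
    by (rule DERIV_cong[OF DERIV_norm_powr]) (use that in \<open>auto simp: inner_axis\<close>)
  ultimately show ?case by blast
next
  case (coord j)
  define c :: real where "c = (if i = j then 1 else 0)"
  have "homogeneous (1 - 1) (\<lambda>x. c * norm x powr (1 - 1))" by (intro homogeneous.intros)
  moreover have "((\<lambda>t. (x + t *\<^sub>R axis i 1) $ j) has_real_derivative c * norm x powr (1 - 1)) (at 0)"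
    if "x \<noteq> 0" for x
    using that by (auto intro!: derivative_eq_intros simp: axis_def c_def)
  ultimately show ?case by blast
next
  case (cmult d f c)
  then obtain D where D: "homogeneous (d - 1) D"
    "\<And>x. x \<noteq> 0 \<Longrightarrow> ((\<lambda>t. f (x + t *\<^sub>R axis i 1)) has_real_derivative D x) (at 0)" by blast
  show ?case
    by (intro exI[of _ "\<lambda>x. c * D x"] conjI allI impI homogeneous.cmult D DERIV_cmult)
next
  case (add d f g)
  then obtain D D' where D: "homogeneous (d - 1) D" "homogeneous (d - 1) D'"
    "\<And>x. x \<noteq> 0 \<Longrightarrow> ((\<lambda>t. f (x + t *\<^sub>R axis i 1)) has_real_derivative D x) (at 0)"
    "\<And>x. x \<noteq> 0 \<Longrightarrow> ((\<lambda>t. g (x + t *\<^sub>R axis i 1)) has_real_derivative D' x) (at 0)" by blast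
  show ?case
    by (intro exI[of _ "\<lambda>x. D x + D' x"] conjI allI impI homogeneous.add D DERIV_add)
next
  case (mult d f e g)
  then obtain D D' where D: "homogeneous (d - 1) D" "homogeneous (e - 1) D'"
    "\<And>x. x \<noteq> 0 \<Longrightarrow> ((\<lambda>t. f (x + t *\<^sub>R axis i 1)) has_real_derivative D x) (at 0)"
    "\<And>x. x \<noteq> 0 \<Longrightarrow> ((\<lambda>t. g (x + t *\<^sub>R axis i 1)) has_real_derivative D' x) (at 0)" by blast
  have "homogeneous (d - 1 + e) (\<lambda>x. D x * g x)" "homogeneous (e - 1 + d) (\<lambda>x. D' x * f x)"
    by (intro homogeneous.mult mult D)+
  then have "homogeneous (d + e - 1) (\<lambda>x. D x * g x + D' x * f x)"
    by (intro homogeneous.add) (simp_all add: algebra_simps)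
  moreover have "((\<lambda>t. f (x + t *\<^sub>R axis i 1) * g (x + t *\<^sub>R axis i 1)) has_real_derivative D x * g x + D' x * f x) (at 0)"
    if "x \<noteq> 0" for x
    using DERIV_mult[OF D(3,4)[OF that]] by simp
  ultimately show ?case by blast
qed

lemma homogeneous_pd:
  assumes "homogeneous d f"
  obtains F where "\<And>L. homogeneous (d - real (length L)) (F L)" "\<And>x L. x \<noteq> 0 \<Longrightarrow> pd L f x = F L x"
    "partially_smooth (- {0}) f"
proof -
  define G where "G i g D \<longleftrightarrow> (\<forall>x. x \<noteq> 0 \<longrightarrow> ((\<lambda>t. g (x + t *\<^sub>R axis i 1)) has_real_derivative D x) (at 0))"
    for i :: 'a and g D :: "real^'a \<Rightarrow> real"
  define F where "F L = rec_list f (\<lambda>i L g. SOME D. homogeneous (d - real (length (i # L))) D \<and> G i g D) L" for L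
  have F_Nil: "F [] = f" by (simp add: F_def)
  have F_Cons: "F (i # L) = (SOME D. homogeneous (d - real (length (i # L))) D \<and> G i (F L) D)" for i L
    by (simp add: F_def)
  have hom: "homogeneous (d - real (length L)) (F L)" for L
  proof (induction L)
    case (Cons i L)
    from homogeneous_pderiv[OF this, of i]
    have "\<exists>D. homogeneous (d - real (length (i # L))) D \<and> G i (F L) D"
      unfolding G_def by (simp add: algebra_simps)
    then show ?case unfolding F_Cons by (rule someI2_ex) blast
  qed (simp add: F_Nil assms)
  have der: "((\<lambda>t. F L (x + t *\<^sub>R axis i 1)) has_real_derivative F (i # L) x) (at 0)" if "x \<in> - {0}" for L i x
  proof -
    from homogeneous_pderiv[OF hom[of L], of i]
    have "\<exists>D. homogeneous (d - real (length (i # L))) D \<and> G i (F L) D"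
      unfolding G_def by (simp add: algebra_simps)
    then have "G i (F L) (F (i # L))" unfolding F_Cons by (rule someI2_ex) blast
    then show ?thesis using that unfolding G_def by simp
  qed
  note fam = pd_family[of "- {0}" F f, OF _ _ der]
  show thesis
    by (rule that[of F]) (use hom fam F_Nil in auto)
qed

text \<open>By homogeneity \<open>|x|^(-d) (e(x - y) - e(x)) = e(v) - e(u)\<close> with \<open>u = x / |x|\<close> and \<open>v = u - y / |x|\<close>. For bounded \<open>y\<close> and
  large \<open>|x|\<close> both points lie in a fixed compact annulus and are close to each other, so uniform continuity of \<open>e\<close> on
  the annulus makes the difference small.\<close>

lemma homogeneous_potential_asymptotics:
  assumes e: "homogeneous d e" and f: "bounded_borel_cs f"
  shows "((\<lambda>x. norm x powr (- d) * \<bar>conv e f x - (LINT y|lborel. f y) * e x\<bar>) \<longlongrightarrow> 0) at_infinity"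
  unfolding tendsto_iff eventually_at_infinity
proof (intro allI impI)
  fix \<epsilon> :: real assume "\<epsilon> > 0"
  obtain \<rho> where \<rho>: "\<rho> > 0" "\<And>y. norm y > \<rho> \<Longrightarrow> f y = 0" using bounded_borel_cs_support[OF f] by metis
  define I where "I = (LINT y|lborel. \<bar>f y\<bar>)"
  have fi: "integrable lborel f" by (rule bounded_borel_cs_integrable[OF f])
  have "I \<ge> 0" unfolding I_def by simp
  define \<eta> where "\<eta> = \<epsilon> / (I + 1)"
  have "\<eta> > 0" unfolding \<eta>_def using \<open>\<epsilon> > 0\<close> \<open>I \<ge> 0\<close> by simp
  define K :: "(real^'a) set" where "K = cball 0 2 - ball 0 (1/2)"
  have "compact K" unfolding K_def by (intro compact_diff) auto
  moreover have "continuous_on K e"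
    by (rule continuous_on_subset[OF homogeneous_continuous[OF e]]) (auto simp: K_def)
  ultimately have "uniformly_continuous_on K e" by (rule compact_uniformly_continuous[rotated])
  then obtain \<delta> where \<delta>: "\<delta> > 0" "\<And>u v. u \<in> K \<Longrightarrow> v \<in> K \<Longrightarrow> dist v u < \<delta> \<Longrightarrow> dist (e v) (e u) < \<eta>"
    using \<open>\<eta> > 0\<close> unfolding uniformly_continuous_on_def by metis
  define R where "R = max (2 * \<rho>) (\<rho> / \<delta> + 1)"
  have "dist (norm x powr (- d) * \<bar>conv e f x - (LINT y|lborel. f y) * e x\<bar>) 0 < \<epsilon>" if "R \<le> norm x" for x
  proof -
    define t where "t = norm x"
    have t: "t > 0" "2 * \<rho> \<le> t" "\<rho> / \<delta> < t" using that \<rho>(1) unfolding t_def R_def by auto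
    have near: "\<bar>e (x - y) - e x\<bar> \<le> t powr d * \<eta>" if "norm y \<le> \<rho>" for y
    proof -
      define u where "u = (1 / t) *\<^sub>R x"
      define v where "v = (1 / t) *\<^sub>R (x - y)"
      have nu: "norm u = 1" unfolding u_def t_def using t(1) by (simp add: t_def)
      have uv: "u - v = (1 / t) *\<^sub>R y" unfolding u_def v_def by (simp add: scaleR_diff_right)
      have ny: "norm (u - v) = norm y / t" unfolding uv using t(1) by simp
      have half: "norm y / t \<le> 1 / 2" using that t by (simp add: divide_le_eq)
      have small: "norm y / t < \<delta>"
      proof -
        have "\<rho> < \<delta> * t" using t(3) \<delta>(1) by (simp add: divide_less_eq mult.commute)
        then show ?thesis using that t(1) by (simp add: divide_less_eq)
      qed
      have "\<bar>norm v - 1\<bar> \<le> norm y / t"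
        using nu ny norm_triangle_ineq3[of u v] by (simp add: abs_minus_commute)
      then have "norm v \<le> 2" "1 / 2 \<le> norm v" using half by linarith+
      then have "u \<in> K" "v \<in> K" "dist v u < \<delta>"
        using nu small ny unfolding K_def by (auto simp: dist_norm norm_minus_commute)
      then have "\<bar>e v - e u\<bar> \<le> \<eta>" using \<delta>(2) by (fastforce simp: dist_real_def)
      moreover have "e (x - y) = t powr d * e v" "e x = t powr d * e u"
        using homogeneous_scale[OF e t(1), of v] homogeneous_scale[OF e t(1), of u] t(1)
        unfolding u_def v_def by simp_all
      ultimately show ?thesis
        using t(1) by (simp add: right_diff_distrib[symmetric] abs_mult)
    qed
    have bd: "\<bar>(e (x - y) - e x) * f y\<bar> \<le> t powr d * \<eta> * \<bar>f y\<bar>" for y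
    proof (cases "norm y \<le> \<rho>")
      case True
      then show ?thesis unfolding abs_mult by (intro mult_right_mono near) auto
    qed (simp add: \<rho>(2))
    have Fi: "integrable lborel (\<lambda>y. t powr d * \<eta> * \<bar>f y\<bar>)" using fi by simp
    have di: "integrable lborel (\<lambda>y. (e (x - y) - e x) * f y)"
    proof (rule Bochner_Integration.integrable_bound[OF Fi])
      have [measurable]: "e \<in> borel_measurable borel" "f \<in> borel_measurable borel"
        using homogeneous_measurable[OF e] bounded_borel_measurable[OF bounded_borel_cs_imp[OF f]] by auto
      show "(\<lambda>y. (e (x - y) - e x) * f y) \<in> borel_measurable lborel" by measurable
      show "AE y in lborel. norm ((e (x - y) - e x) * f y) \<le> norm (t powr d * \<eta> * \<bar>f y\<bar>)"
        using bd by (intro AE_I2) (metis abs_ge_self order_trans real_norm_def)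
    qed
    have "conv e f x = (LINT y|lborel. (e (x - y) - e x) * f y + e x * f y)"
      unfolding conv_def by (simp add: algebra_simps)
    also have "\<dots> = (LINT y|lborel. (e (x - y) - e x) * f y) + e x * (LINT y|lborel. f y)"
      using di fi by simp
    finally have "\<bar>conv e f x - (LINT y|lborel. f y) * e x\<bar> = \<bar>LINT y|lborel. (e (x - y) - e x) * f y\<bar>" by simp
    also have "\<dots> \<le> (LINT y|lborel. t powr d * \<eta> * \<bar>f y\<bar>)"
      by (rule integral_abs_bound_integral[OF di Fi bd])
    also have "\<dots> = t powr d * (\<eta> * I)" by (simp add: I_def)
    finally have "t powr (- d) * \<bar>conv e f x - (LINT y|lborel. f y) * e x\<bar> \<le> t powr (- d) * (t powr d * (\<eta> * I))"
      by (intro mult_left_mono) auto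
    also have "\<dots> = \<eta> * I" using t(1) by (simp add: powr_minus)
    also have "\<dots> < \<epsilon>" unfolding \<eta>_def using \<open>\<epsilon> > 0\<close> \<open>I \<ge> 0\<close> by (simp add: divide_less_eq distrib_left)
    finally show ?thesis by (simp add: t_def)
  qed
  then show "\<exists>b. \<forall>x. b \<le> norm x \<longrightarrow> dist (norm x powr (- d) * \<bar>conv e f x - (LINT y|lborel. f y) * e x\<bar>) 0 < \<epsilon>"
    by blast
qed

section \<open>Asymptotics of the stationary solution\<close>

lemma exp_decay_beats_powr:
  assumes "c > 0" and g: "\<And>x. norm x > R \<Longrightarrow> \<bar>g x\<bar> \<le> A * exp (- c * norm x)"
  shows "((\<lambda>x::'a::real_normed_vector. norm x powr p * \<bar>g x\<bar>) \<longlongrightarrow> 0) at_infinity"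
proof (rule tendsto_sandwich[OF _ _ tendsto_const])
  have "((\<lambda>t::real. t powr p * (A * exp (- c * t))) \<longlongrightarrow> 0) at_top"
    using \<open>c > 0\<close> by real_asymp
  then show "((\<lambda>x::'a. norm x powr p * (A * exp (- c * norm x))) \<longlongrightarrow> 0) at_infinity"
    by (rule filterlim_compose) (rule filterlim_norm_at_top)
  show "\<forall>\<^sub>F x in at_infinity. 0 \<le> norm x powr p * \<bar>g x\<bar>" by simp
  have "norm x powr p * \<bar>g x\<bar> \<le> norm x powr p * (A * exp (- c * norm x))" if "norm x \<ge> R + 1" for x
    using g[of x] that by (intro mult_left_mono) auto
  then show "\<forall>\<^sub>F x in at_infinity. norm x powr p * \<bar>g x\<bar> \<le> norm x powr p * (A * exp (- c * norm x))"
    unfolding eventually_at_infinity by blast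
qed

lemma newton_pd:
  obtains e where "\<And>L. homogeneous (2 - real CARD('n) - real (length L)) (e L)"
    "\<And>L x. x \<noteq> 0 \<Longrightarrow> pd L (newton :: real^'n::finite \<Rightarrow> real) x = e L x"
    "partially_smooth (- {0}) (newton :: real^'n \<Rightarrow> real)"
    "\<And>L. continuous_on (- {0}) (pd L (newton :: real^'n \<Rightarrow> real))"
proof -
  have "homogeneous (2 - real CARD('n)) (newton :: real^'n \<Rightarrow> real)"
    unfolding newton_def[abs_def] by (rule homogeneous.norm_powr)
  then obtain e where e: "\<And>L. homogeneous (2 - real CARD('n) - real (length L)) (e L)"
    "\<And>x L. x \<noteq> 0 \<Longrightarrow> pd L (newton :: real^'n \<Rightarrow> real) x = e L x"
    "partially_smooth (- {0}) (newton :: real^'n \<Rightarrow> real)"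
    using homogeneous_pd by blast
  have "continuous_on (- {0}) (pd L (newton :: real^'n \<Rightarrow> real))" for L
    by (rule continuous_on_eq[OF homogeneous_continuous[OF e(1)]]) (simp add: e(2))
  with e show thesis using that by blast
qed

context jump_kernel
begin

text \<open>Near \<open>x\<close> the function \<open>w\<close> is the convolution of \<open>J\<close> with a cut-off \<open>h\<close> of \<open>w\<close>. All derivatives fall on \<open>J\<close>, so they are bounded by the
  supremum of \<open>|w|\<close> on the unit ball around \<open>x\<close>.\<close>

lemma pd_of_J_averaged:
  assumes J: "smooth_on UNIV J" and w: "bounded_borel w" "\<And>x. norm x > R \<Longrightarrow> conv J w x = w x"
    and "c > 0" and decay: "\<And>x. \<bar>w x\<bar> \<le> A * exp (- c * norm x)" and "A > 0"
  shows "partially_smooth {x. norm x > R + 1} w"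
    and "\<exists>B. \<forall>x. norm x > R + 1 \<longrightarrow> \<bar>pd L w x\<bar> \<le> B * exp (- c * norm x)"
proof -
  have DJ: "continuous_on UNIV (pd L J)" and DJ_smooth: "partially_smooth UNIV J" for L
    using smooth_on_UNIV_pd[OF J] by auto
  have DJ0: "pd L J z = 0" if "norm z > 1" for L z
  proof -
    have "open {z :: (real, 'n) vec. norm z > 1}" by (intro open_Collect_less continuous_intros)
    from pd_family(1)[OF this, of "\<lambda>_ _. 0" J z L] show ?thesis using that J_support by simp
  qed
  have near: "partially_smooth (ball x 1) w \<and> pd L w x = conv (pd L J) (\<lambda>y. w y * indicator (cball x 2) y) x"
    if x: "norm x > R + 1" for x L
  proof -
    \<comment> \<open>Radius 2 because \<open>w\<close> is needed within distance 1 of all points of the unit ball around \<open>x\<close>.\<close>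
    define h where "h y = w y * indicator (cball x 2) y" for y
    have h: "bounded_borel h"
      unfolding h_def[abs_def] by (intro bounded_borel_mult[OF w(1)] bounded_borel_indicator) simp
    have eq: "conv J h y = w y" if "y \<in> ball x 1" for y
    proof -
      have "conv J h y = conv J w y"
      proof (rule conv_cong[where r = 1])
        fix u assume "norm (y - u) \<le> 1"
        then have "u \<in> cball x 2" using that dist_triangle[of x u y] by (simp add: dist_norm)
        then show "h u = w u" by (simp add: h_def)
      qed (rule J_support)
      moreover have "norm y > R" using x that norm_triangle_sub[of x y] by (simp add: dist_norm)
      ultimately show ?thesis using w(2) by simp
    qed
    have S: "compact (cball x 2)" "\<And>y. y \<notin> cball x 2 \<Longrightarrow> h y = 0" by (auto simp: h_def)
    have c: "pd L (conv J h) y = conv (pd L J) h y" "partially_smooth UNIV (conv J h)" for L y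
      by (rule pd_conv[where S = "cball x 2" and V = UNIV, OF open_UNIV DJ_smooth DJ S(1) h];
          use S(2) in auto)+
    have sm: "partially_smooth (ball x 1) (conv J h)"
      using c(2) unfolding partially_smooth_def by simp
    note loc = pd_cong[OF open_ball eq sm]
    have "pd L w x = conv (pd L J) h x" using loc(1)[of x L] c(1)[of L x] by simp
    then show ?thesis using loc(2) unfolding h_def[abs_def] by blast
  qed
  then have local: "partially_smooth (ball x 1) w" if "norm x > R + 1" for x using that by blast
  have "((\<lambda>t. pd L w (x + t *\<^sub>R axis i 1)) has_real_derivative pd (i # L) w x) (at 0)"
    if "norm x > R + 1" for x L i
    using partially_smoothD[OF local[OF that], of x] by simp
  then show "partially_smooth {x. norm x > R + 1} w"
    unfolding partially_smooth_def by blast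
  define I where "I = (LINT y|lborel. \<bar>pd L J y\<bar>)"
  have "\<bar>pd L w x\<bar> \<le> I * A * exp c * exp (- c * norm x)" if x: "norm x > R + 1" for x
  proof -
    define h where "h y = w y * indicator (cball x 2) y" for y
    have "\<bar>pd L w x\<bar> = \<bar>conv (pd L J) h x\<bar>" using near[OF x, of L] unfolding h_def[abs_def] by simp
    also have "\<dots> \<le> I * (A * exp (c - c * norm x))"
      unfolding I_def
    proof (rule conv_abs_le[OF _ _ _ DJ0])
      show "bounded_borel_cs (pd L J)" by (rule continuous_cs_bounded_borel_cs[OF DJ DJ0])
      show "bounded_borel h"
        unfolding h_def[abs_def] by (intro bounded_borel_mult[OF w(1)] bounded_borel_indicator) simp
      fix y assume y: "norm (x - y) \<le> 1"
      have "\<bar>h y\<bar> \<le> \<bar>w y\<bar>" by (simp add: h_def indicator_def)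
      also have "\<dots> \<le> A * exp (- c * norm y)" by (rule decay)
      also have "\<dots> \<le> A * exp (c - c * norm x)"
      proof -
        have "norm x \<le> 1 + norm y" using y norm_triangle_sub[of x y] by simp
        then have "c * norm x \<le> c * (1 + norm y)" using \<open>c > 0\<close> by simp
        then show ?thesis using \<open>A > 0\<close> by (simp add: distrib_left)
      qed
      finally show "\<bar>h y\<bar> \<le> A * exp (c - c * norm x)" .
    qed
    also have "\<dots> = I * A * exp c * exp (- c * norm x)" by (simp add: exp_diff exp_minus field_simps)
    finally show ?thesis .
  qed
  then show "\<exists>B. \<forall>x. norm x > R + 1 \<longrightarrow> \<bar>pd L w x\<bar> \<le> B * exp (- c * norm x)" by blast
qed

lemma pd_asymptotics:
  assumes J: "smooth_on UNIV J"
    and \<psi>: "bounded_borel \<psi>" "(\<psi> \<longlongrightarrow> 0) at_infinity" "bounded_borel_cs (\<lambda>x. \<psi> x - conv J \<psi> x)"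
  defines "C \<equiv> (LINT x|lborel. \<psi> x - conv J \<psi> x) / (LINT x|lborel. defect x)"
  shows "((\<lambda>x. norm x powr (real CARD('n) - 2 + real (length L)) *
     \<bar>pd L \<psi> x - pd L (\<lambda>y. C * norm y powr (2 - real CARD('n))) x\<bar>) \<longlongrightarrow> 0) at_infinity"
proof -
  define f where "f x = \<psi> x - conv J \<psi> x" for x
  define b where "b = 1 / (LINT x|lborel. defect x)"
  have b: "b > 0" unfolding b_def using defect_mass_pos by simp
  have f: "bounded_borel_cs f" unfolding f_def[abs_def] by (rule \<psi>(3))
  have C: "C = b * (LINT x|lborel. f x)" unfolding C_def b_def f_def by simp
  obtain \<rho> where \<rho>: "\<And>x. norm x > \<rho> \<Longrightarrow> f x = 0" "\<rho> > 0" using bounded_borel_cs_support[OF f] by metis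
  obtain w A c R where w: "\<And>x. \<psi> x = conv f P x / (LINT x|lborel. defect x) + w x" "bounded_borel w"
    "0 < A" "0 < c" "\<And>x. \<bar>w x\<bar> \<le> A * exp (- c * norm x)" "\<And>x. norm x > R \<Longrightarrow> conv J w x = w x"
    using potential_approximation[OF \<psi>, folded f_def[abs_def]] by blast
  note w_pd = pd_of_J_averaged[OF J w(2,6,4,5,3)]
  obtain e where e: "\<And>L. homogeneous (2 - real CARD('n) - real (length L)) (e L)"
    "\<And>L x. x \<noteq> 0 \<Longrightarrow> pd L (newton :: (real, 'n) vec \<Rightarrow> real) x = e L x"
    "partially_smooth (- {0}) (newton :: (real, 'n) vec \<Rightarrow> real)"
    "\<And>L. continuous_on (- {0}) (pd L (newton :: (real, 'n) vec \<Rightarrow> real))"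
    using newton_pd by blast
  define V where "V = {x :: (real, 'n) vec. norm x > max (\<rho> + 1) (R + 1)}"
  have V: "open V" unfolding V_def by (intro open_Collect_less continuous_intros)
  have sep: "x - y \<in> - {0}" if "x \<in> V" "y \<in> cball 0 \<rho>" for x y
    using that unfolding V_def by auto
  have fb: "bounded_borel f" by (rule bounded_borel_cs_imp[OF f])
  have f0: "f y = 0" if "y \<notin> cball 0 \<rho>" for y using that \<rho>(1) by simp
  have op0: "open (- {0 :: (real, 'n) vec})" by (simp add: open_Compl)
  have v_pd: "x \<in> V \<Longrightarrow> pd L (conv newton f) x = conv (pd L newton) f x"
    "partially_smooth V (conv newton f)" for x L
    by (rule pd_conv[where S = "cball 0 \<rho>" and V = V, OF op0 e(3,4) compact_cball fb _ V];
        use f0 sep in blast)+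
  have v_eq: "conv f P x = conv newton f x" if "x \<in> V" for x
  proof -
    have "P (x - y) * f y = newton (x - y) * f y" for y
    proof (cases "norm y \<le> \<rho>")
      case True
      then have "norm (x - y) \<ge> 1" using that norm_triangle_ineq2[of x y] unfolding V_def by simp
      then show ?thesis by (simp add: capped_newton_eq)
    qed (simp add: \<rho>(1))
    then show ?thesis unfolding conv_commute[of f P] conv_def by presburger
  qed
  have pd_\<psi>: "pd L \<psi> x = b * conv (e L) f x + pd L w x" if "x \<in> V" for x L
  proof -
    have "pd L \<psi> x = b * pd L (conv newton f) x + pd L w x"
    proof (rule pd_family(1)[OF V _ _ that])
      show "b * pd [] (conv newton f) x + pd [] w x = \<psi> x" if "x \<in> V" for x
        using w(1)[of x] v_eq[OF that] by (simp add: b_def)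
      fix L i x assume x: "x \<in> V"
      then have "x \<in> {x. norm x > R + 1}" by (simp add: V_def)
      then show "((\<lambda>t. b * pd L (conv newton f) (x + t *\<^sub>R axis i 1) + pd L w (x + t *\<^sub>R axis i 1))
          has_real_derivative b * pd (i # L) (conv newton f) x + pd (i # L) w x) (at 0)"
        by (intro DERIV_add DERIV_cmult partially_smoothD[OF v_pd(2) x] partially_smoothD[OF w_pd(1)])
    qed
    also have "pd L (conv newton f) x = conv (pd L newton) f x" by (rule v_pd(1)[OF that])
    also have "\<dots> = conv (e L) f x"
    proof -
      have "pd L newton (x - y) * f y = e L (x - y) * f y" for y
        using e(2)[of "x - y" L] sep[OF that, of y] f0[of y] by (cases "y \<in> cball 0 \<rho>") auto
      then show ?thesis unfolding conv_def by presburger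
    qed
    finally show ?thesis .
  qed
  have pd_C: "pd L (\<lambda>y. C * norm y powr (2 - real CARD('n))) x = C * e L x" if "x \<noteq> 0" for x :: "(real, 'n) vec"
  proof -
    have "pd L (\<lambda>y. C * newton y) x = C * pd L newton x"
      using that by (intro pd_family(1)[OF op0, where F = "\<lambda>L x. C * pd L newton x"] DERIV_cmult partially_smoothD[OF e(3)]) auto
    then show ?thesis using e(2)[OF that] by (simp add: newton_def)
  qed
  define p where "p = real CARD('n) - 2 + real (length L)"
  have p: "- (2 - real CARD('n) - real (length L)) = p" by (simp add: p_def)
  obtain B where B: "\<And>x. norm x > R + 1 \<Longrightarrow> \<bar>pd L w x\<bar> \<le> B * exp (- c * norm x)" using w_pd(2) by blast
  have "((\<lambda>x. b * (norm x powr p * \<bar>conv (e L) f x - (LINT y|lborel. f y) * e L x\<bar>)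
      + norm x powr p * \<bar>pd L w x\<bar>) \<longlongrightarrow> b * 0 + 0) at_infinity"
    using homogeneous_potential_asymptotics[OF e(1)[of L] f] exp_decay_beats_powr[OF w(4) B]
    unfolding p by (intro tendsto_add tendsto_mult_left)
  then have lim: "((\<lambda>x. b * (norm x powr p * \<bar>conv (e L) f x - (LINT y|lborel. f y) * e L x\<bar>)
      + norm x powr p * \<bar>pd L w x\<bar>) \<longlongrightarrow> 0) at_infinity" by simp
  have le: "norm x powr p * \<bar>pd L \<psi> x - pd L (\<lambda>y. C * norm y powr (2 - real CARD('n))) x\<bar>
      \<le> b * (norm x powr p * \<bar>conv (e L) f x - (LINT y|lborel. f y) * e L x\<bar>) + norm x powr p * \<bar>pd L w x\<bar>"
    if "x \<in> V" for x
  proof -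
    have "x \<noteq> 0" using that \<rho>(2) unfolding V_def by auto
    have "\<bar>pd L \<psi> x - pd L (\<lambda>y. C * norm y powr (2 - real CARD('n))) x\<bar>
        = \<bar>b * (conv (e L) f x - (LINT y|lborel. f y) * e L x) + pd L w x\<bar>"
      unfolding pd_\<psi>[OF that] pd_C[OF \<open>x \<noteq> 0\<close>] unfolding C by (simp add: algebra_simps)
    also have "\<dots> \<le> b * \<bar>conv (e L) f x - (LINT y|lborel. f y) * e L x\<bar> + \<bar>pd L w x\<bar>"
      using b abs_triangle_ineq[of "b * (conv (e L) f x - (LINT y|lborel. f y) * e L x)" "pd L w x"]
      by (simp add: abs_mult)
    finally have "norm x powr p * \<bar>pd L \<psi> x - pd L (\<lambda>y. C * norm y powr (2 - real CARD('n))) x\<bar>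
        \<le> norm x powr p * (b * \<bar>conv (e L) f x - (LINT y|lborel. f y) * e L x\<bar> + \<bar>pd L w x\<bar>)"
      by (intro mult_left_mono) auto
    then show ?thesis by (simp add: distrib_left mult.left_commute)
  qed
  have "((\<lambda>x. norm x powr p * \<bar>pd L \<psi> x - pd L (\<lambda>y. C * norm y powr (2 - real CARD('n))) x\<bar>) \<longlongrightarrow> 0) at_infinity"
  proof (rule tendsto_sandwich[OF _ _ tendsto_const lim])
    have "x \<in> V" if "norm x \<ge> max (\<rho> + 1) (R + 1) + 1" for x using that unfolding V_def by auto
    then show "\<forall>\<^sub>F x in at_infinity. norm x powr p * \<bar>pd L \<psi> x - pd L (\<lambda>y. C * norm y powr (2 - real CARD('n))) x\<bar>
      \<le> b * (norm x powr p * \<bar>conv (e L) f x - (LINT y|lborel. f y) * e L x\<bar>) + norm x powr p * \<bar>pd L w x\<bar>"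
      unfolding eventually_at_infinity using le by blast
  qed simp
  then show ?thesis unfolding p_def .
qed

text \<open>As \<open>\<phi>\<close> agrees with the continuous function \<open>J * \<phi>\<close> off the open set \<open>H\<close> and vanishes on \<open>H\<close>, it is a bounded
  Borel function; its equation can fail only on the bounded set \<open>H\<close>.\<close>

lemma stationary_solution_regular:
  assumes "open H" "bounded H" and sol: "stationary_solution J H \<phi>"
  shows "bounded_borel (\<lambda>x. 1 - \<phi> x)" and "((\<lambda>x. 1 - \<phi> x) \<longlongrightarrow> 0) at_infinity"
    and "bounded_borel_cs (\<lambda>x. (1 - \<phi> x) - conv J (\<lambda>x. 1 - \<phi> x) x)"
proof -
  have loc: "locally_integrable \<phi>" and eq: "\<And>x. x \<notin> H \<Longrightarrow> convol J \<phi> x = \<phi> x"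
    and 0: "\<And>x. x \<in> H \<Longrightarrow> \<phi> x = 0" and lim: "(\<phi> \<longlongrightarrow> 1) at_infinity"
    using sol unfolding stationary_solution_def by auto
  have cont: "continuous_on UNIV (convol J \<phi>)" by (rule continuous_convol[OF J_cont J_support loc])
  have "\<phi> = (\<lambda>x. indicator (- H) x * convol J \<phi> x)"
    using eq 0 by (auto simp: indicator_def)
  moreover have "(\<lambda>x. indicator (- H) x * convol J \<phi> x) \<in> borel_measurable borel"
    using \<open>open H\<close> borel_measurable_continuous_onI[OF cont]
    by (intro borel_measurable_times borel_measurable_indicator) auto
  ultimately have meas: "\<phi> \<in> borel_measurable borel" by simp
  obtain b where b: "\<And>x. norm x \<ge> b \<Longrightarrow> \<bar>\<phi> x - 1\<bar> < 1"
    using lim unfolding tendsto_iff eventually_at_infinity dist_real_def by (metis zero_less_one)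
  have "compact (convol J \<phi> ` cball 0 b)"
    by (intro compact_continuous_image continuous_on_subset[OF cont]) auto
  then obtain M where M: "\<And>x. x \<in> cball 0 b \<Longrightarrow> \<bar>convol J \<phi> x\<bar> \<le> M"
    using compact_imp_bounded[of "convol J \<phi> ` cball 0 b"] unfolding bounded_iff by (metis imageI real_norm_def)
  have bd: "\<bar>\<phi> x\<bar> \<le> max 2 \<bar>M\<bar>" for x
  proof (cases "norm x \<ge> b")
    case True then show ?thesis using b[of x] by auto
  next
    case False then show ?thesis using M[of x] eq[of x] 0[of x] by (cases "x \<in> H") auto
  qed
  then have \<phi>: "bounded_borel \<phi>" using meas unfolding bounded_borel_def by blast
  then show \<psi>: "bounded_borel (\<lambda>x. 1 - \<phi> x)" by (intro bounded_borel_diff bounded_borel_const)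
  show "((\<lambda>x. 1 - \<phi> x) \<longlongrightarrow> 0) at_infinity" using tendsto_diff[OF tendsto_const lim, of 1] by simp
  have f_eq: "(1 - \<phi> x) - conv J (\<lambda>x. 1 - \<phi> x) x = convol J \<phi> x - \<phi> x" for x
    using conv_diff[OF J_cs bounded_borel_const \<phi>] conv_J_const convol_eq_conv[OF J_measurable meas] by simp
  obtain r where r: "\<And>x. x \<in> H \<Longrightarrow> norm x \<le> r" using \<open>bounded H\<close> unfolding bounded_iff by blast
  have "(1 - \<phi> x) - conv J (\<lambda>x. 1 - \<phi> x) x = 0" if "norm x > r" for x
    unfolding f_eq using r[of x] eq[of x] that by auto
  moreover have "bounded_borel (\<lambda>x. (1 - \<phi> x) - conv J (\<lambda>x. 1 - \<phi> x) x)"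
    by (intro bounded_borel_diff[OF \<psi>] bounded_borel_conv J_cs \<psi>)
  ultimately show "bounded_borel_cs (\<lambda>x. (1 - \<phi> x) - conv J (\<lambda>x. 1 - \<phi> x) x)"
    unfolding bounded_borel_cs_def by blast
qed

end

lemma dispersal_kernel_jump_kernel:
  fixes J :: "(real, 'n::{finite,wellorder}) vec \<Rightarrow> real"
  assumes "CARD('n) \<ge> 3" and J: "dispersal_kernel J"
  shows "jump_kernel J"
proof -
  have J': "0 \<le> J x" "norm x = norm y \<Longrightarrow> J x = J y" "0 < J 0" "closure {x. J x \<noteq> 0} \<subseteq> cball 0 1"
    "(LINT x|lebesgue. J x) = 1" "Ck_on 0 UNIV J" for x y
    using J unfolding dispersal_kernel_def smooth_on_def by blast+
  have cont: "continuous_on UNIV J" using J'(6) by simp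
  have supp: "J x = 0" if "norm x > 1" for x
  proof (rule ccontr)
    assume "J x \<noteq> 0"
    then have "x \<in> closure {x. J x \<noteq> 0}" by (intro subsetD[OF closure_subset]) simp
    then show False using J'(4) that by auto
  qed
  have "(LINT x|lborel. J x) = (LINT x|lebesgue. J x)"
    by (rule integral_completion[symmetric]) (simp add: borel_measurable_continuous_onI[OF cont])
  then have mass: "(LINT x|lborel. J x) = 1" using J'(5) by simp
  show ?thesis
    by unfold_locales (fact assms(1) cont J' supp mass)+
qed

theorem proposition3p3:
  fixes H :: "(real^'n::{finite,wellorder}) set"
    and J \<phi> :: "real^'n::{finite,wellorder} \<Rightarrow> real"
  assumes "CARD('n) \<ge> 3"
    and "open H" and "bounded H" and "smooth_boundary H" and "0 \<in> H"
    and "dispersal_kernel J"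
    and "stationary_solution J H \<phi>"
  shows "\<exists>C. \<forall>\<beta>::nat^'n::{finite,wellorder}.
    ((\<lambda>x. norm x powr (real CARD('n) - 2 + real (multi_order \<beta>)) *
        \<bar>multi_deriv \<beta> (\<lambda>y. 1 - \<phi> y) x
          - multi_deriv \<beta> (\<lambda>y. C * norm y powr (2 - real CARD('n))) x\<bar>)
      \<longlongrightarrow> 0) at_infinity"
proof -
  interpret jump_kernel J using dispersal_kernel_jump_kernel assms(1,6) by blast
  have J: "smooth_on UNIV J" using assms(6) by (simp add: dispersal_kernel_def)
  note \<psi> = stationary_solution_regular[OF assms(2,3,7)]
  show ?thesis
  proof (intro exI allI)
    fix \<beta> :: "(nat, 'n) vec"
    obtain L :: "'n list" where L: "length L = multi_order \<beta>" "\<And>f. multi_deriv \<beta> f = pd L f"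
      using multi_deriv_eq_pd[of \<beta>] by blast
    show "((\<lambda>x. norm x powr (real CARD('n) - 2 + real (multi_order \<beta>)) *
        \<bar>multi_deriv \<beta> (\<lambda>y. 1 - \<phi> y) x - multi_deriv \<beta> (\<lambda>y.
           ((LINT x|lborel. (1 - \<phi> x) - conv J (\<lambda>x. 1 - \<phi> x) x) / (LINT x|lborel. defect x))
             * norm y powr (2 - real CARD('n))) x\<bar>) \<longlongrightarrow> 0) at_infinity"
      unfolding L(2) L(1)[symmetric] by (rule pd_asymptotics[OF J \<psi>])
  qed
qed

end
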